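(* Let $\lambda\in 2\mathbb{Z}$, and let $N_\lambda^C$ be the unique maximal submodule of the $\mathfrak{sl}_2(\mathbb{C})$-module $M_\lambda^C=U(I_\lambda)/U(I_\lambda)C$. Then $N_\lambda^C$ is a $\mathbb{Z}_2^2$-graded $\mathfrak{sl}_2(\mathbb{C})$-module which is graded-simple.
   Context: Let $x=\begin{bmatrix}0&1\\0&0\end{bmatrix}$, $h=\begin{bmatrix}1&0\\0&-1\end{bmatrix}$, $y=\begin{bmatrix}0&0\\1&0\end{bmatrix}$ be the standard basis of $\mathfrak{sl}_2(\mathbb{C})$ and put $B=x+y=\begin{bmatrix}0&1\\1&0\end{bmatrix}$, $C=x-y=\begin{bmatrix}0&1\\-1&0\end{bmatrix}$. Let $c=(h+1)^2+4yx\in U(\mathfrak{sl}_2(\mathbb{C}))$ be the Casimir element. For $\lambda\in\mathbb{C}$, let $I_\lambda$ be the two-sided ideal of $U(\mathfrak{sl}_2(\mathbb{C}))$ generated by the central element $c-(\lambda+1)^2$, and let $U(I_\lambda)=U(\mathfrak{sl}_2(\mathbb{C}))/I_\lambda$. $M_\lambda^C=U(I_\lambda)/U(I_\lambda)C$ is the quotient of the left regular module by the left ideal generated by the image of $C$. For $\lambda\in2\mathbb{Z}$ this module has a unique maximal (proper) submodule, denoted $N_\lambda^C$. The Pauli grading of $\mathfrak{sl}_2(\mathbb{C})$ by $\mathbb{Z}_2^2$ is $L_{(1,0)}=\langle h\rangle$, $L_{(0,1)}=\langle B\rangle$, $L_{(1,1)}=\langle C\rangle$. It extends uniquely to a $\mathbb{Z}_2^2$-grading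 of the associative algebra $U(\mathfrak{sl}_2(\mathbb{C}))$, and the $\mathbb{Z}_2^2$-grading on $M_\lambda^C$ is the one induced by passing to quotients. A submodule $W$ of a graded module $M=\bigoplus_g M_g$ is graded if $W=\bigoplus_g(W\cap M_g)$; the grading on $N_\lambda^C$ is the one given by $N_\lambda^C\cap (M_\lambda^C)_g$. A graded module is graded-simple if it has no graded submodules other than $\{0\}$ and itself. *)

theory Defs
  imports
    "HOL-Analysis.Analysis"
    "HOL-Algebra.Algebra"
    "HOL-Library.Poly_Mapping"
    "HOL-Library.Product_Plus"
    "HOL-Library.Z2"
begin

section \<open>The Lie algebra of traceless matrices and its Pauli grading\<close>

definition mat_scale :: "complex \<Rightarrow> complex^2^2 \<Rightarrow> complex^2^2" where
  "mat_scale z A = (\<chi> i j. z * A $ i $ j)"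

definition sl2 :: "(complex^2^2) set" where
  "sl2 = {A. trace A = 0}"

definition lie_bracket :: "complex^2^2 \<Rightarrow> complex^2^2 \<Rightarrow> complex^2^2" where
  "lie_bracket A B = A ** B - B ** A"

definition sl2_x :: "complex^2^2" where "sl2_x = vector [vector [0, 1], vector [0, 0]]"
definition sl2_h :: "complex^2^2" where "sl2_h = vector [vector [1, 0], vector [0, -1]]"
definition sl2_y :: "complex^2^2" where "sl2_y = vector [vector [0, 0], vector [1, 0]]"
definition sl2_B :: "complex^2^2" where "sl2_B = sl2_x + sl2_y"
definition sl2_C :: "complex^2^2" where "sl2_C = sl2_x - sl2_y"

instance bit :: finite
proof
  have "(UNIV :: bit set) = {0, 1}" using bit_not_zero_iff by blast
  then show "finite (UNIV :: bit set)" by (metis finite.emptyI finite.insertI)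
qed

type_synonym Z2sq = "bit \<times> bit"

definition pauli_component :: "Z2sq \<Rightarrow> (complex^2^2) set" where
  "pauli_component g =
    (if g = (1, 0) then {mat_scale z sl2_h | z. True}
     else if g = (0, 1) then {mat_scale z sl2_B | z. True}
     else if g = (1, 1) then {mat_scale z sl2_C | z. True}
     else {0})"

section \<open>Free associative algebras\<close>

text \<open>Words are wrapped in a datatype so that concatenation can serve as the addition of
  class \<^class>\<open>monoid_add\<close>: the convolution product of \<^theory>\<open>HOL-Library.Poly_Mapping\<close> is then
  the product of noncommutative polynomials.\<close>

datatype 'a word = Word (letters: "'a list")

instantiation word :: (type) monoid_add
begin

definition zero_word :: "'a word" where "0 = Word []"
definition plus_word :: "'a word \<Rightarrow> 'a word \<Rightarrow> 'a word" where
  "v + w = Word (letters v @ letters w)"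

instance by standard (simp_all add: zero_word_def plus_word_def)

end

type_synonym 'a ncpoly = "'a word \<Rightarrow>\<^sub>0 complex"

definition nc_const :: "complex \<Rightarrow> 'a ncpoly" where
  "nc_const z = Poly_Mapping.single 0 z"

definition nc_var :: "'a \<Rightarrow> 'a ncpoly" where
  "nc_var a = Poly_Mapping.single (Word [a]) 1"

definition free_algebra :: "'a set \<Rightarrow> 'a ncpoly ring" where
  "free_algebra S =
    \<lparr>carrier = {p. \<forall>w\<in>Poly_Mapping.keys p. set (letters w) \<subseteq> S},
     mult = (*), one = 1, ring.zero = 0, add = (+)\<rparr>"

lemma ring_free_algebra: "ring (free_algebra S)"
proof -
  define K where "K = {p :: 'a ncpoly. \<forall>w\<in>Poly_Mapping.keys p. set (letters w) \<subseteq> S}"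
  have closed: "0 \<in> K" "1 \<in> K" "\<And>p. p \<in> K \<Longrightarrow> - p \<in> K"
    by (simp_all add: K_def zero_word_def)
  have add: "p + q \<in> K" if "p \<in> K" "q \<in> K" for p q
    using that Poly_Mapping.keys_add[of p q] unfolding K_def by blast
  have mult: "p * q \<in> K" if "p \<in> K" "q \<in> K" for p q
    using that keys_mult[of p q] unfolding K_def by (fastforce simp: plus_word_def)
  have "ring \<lparr>carrier = K, mult = (*), one = 1, ring.zero = 0, add = (+)\<rparr>"
  proof (intro ringI abelian_groupI monoidI, simp_all add: closed add mult algebra_simps)
    show "\<exists>q\<in>K. p + q = 0" if "p \<in> K" for p
      using that closed(3) by (intro bexI[of _ "- p"]) auto
  qed
  then show ?thesis
    by (simp add: free_algebra_def K_def)
qed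

section \<open>The universal enveloping algebra\<close>

text \<open>The tensor algebra of the vector space \<^const>\<open>sl2\<close> is the free algebra on its elements
  modulo linearity of the generators; the first two sets of relations express this linearity.\<close>

definition sl2_relations :: "(complex^2^2) ncpoly set" where
  "sl2_relations =
    {nc_var (A + B) - nc_var A - nc_var B | A B. A \<in> sl2 \<and> B \<in> sl2} \<union>
    {nc_var (mat_scale z A) - nc_const z * nc_var A | z A. A \<in> sl2} \<union>
    {nc_var A * nc_var B - nc_var B * nc_var A - nc_var (lie_bracket A B) | A B.
       A \<in> sl2 \<and> B \<in> sl2}"

definition sl2_ideal :: "(complex^2^2) ncpoly set" where
  "sl2_ideal = genideal (free_algebra sl2) sl2_relations"

type_synonym U_elt = "(complex^2^2) ncpoly set"

definition Usl2 :: "U_elt ring" where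
  "Usl2 = free_algebra sl2 Quot sl2_ideal"

definition U_const :: "complex \<Rightarrow> U_elt" where
  "U_const z = sl2_ideal +>\<^bsub>free_algebra sl2\<^esub> nc_const z"

definition U_emb :: "complex^2^2 \<Rightarrow> U_elt" where
  "U_emb A = sl2_ideal +>\<^bsub>free_algebra sl2\<^esub> nc_var A"

lemma sl2_relations_subset: "sl2_relations \<subseteq> carrier (free_algebra sl2)"
proof -
  interpret F: ring "free_algebra sl2" by (rule ring_free_algebra)
  have c: "nc_const z \<in> carrier (free_algebra sl2)" for z
    by (simp add: free_algebra_def nc_const_def zero_word_def)
  have v: "nc_var A \<in> carrier (free_algebra sl2)" if "A \<in> sl2" for A
    using that by (simp add: free_algebra_def nc_var_def)
  have m: "p * q \<in> carrier (free_algebra sl2)"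
    if "p \<in> carrier (free_algebra sl2)" "q \<in> carrier (free_algebra sl2)" for p q
    using F.m_closed[OF that] by (simp add: free_algebra_def)
  have d: "p - q \<in> carrier (free_algebra sl2)"
    if "p \<in> carrier (free_algebra sl2)" "q \<in> carrier (free_algebra sl2)" for p q
    using that Poly_Mapping.keys_diff[of p q] by (force simp: free_algebra_def)
  have tr: "A + B \<in> sl2" "mat_scale z A \<in> sl2" "lie_bracket A B \<in> sl2"
    if "A \<in> sl2" "B \<in> sl2" for A B z
    using that
    by (auto simp: sl2_def trace_add trace_sub lie_bracket_def trace_mul_sym[of A B])
       (simp add: mat_scale_def trace_def flip: sum_distrib_left)
  show ?thesis
    unfolding sl2_relations_def by (auto intro!: c v m d tr)
qed

lemma ideal_sl2_ideal: "ideal sl2_ideal (free_algebra sl2)"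
  unfolding sl2_ideal_def
  by (intro ring.genideal_ideal ring_free_algebra sl2_relations_subset)

lemma ring_Usl2: "ring Usl2"
  unfolding Usl2_def by (rule ideal.quotient_is_ring[OF ideal_sl2_ideal])

text \<open>The unique grading of the enveloping algebra extending the Pauli grading: its components
  are the least family of subspaces that contains the Pauli components, has the scalars in
  degree 0 and is multiplicative.\<close>

inductive U_homogeneous :: "Z2sq \<Rightarrow> U_elt \<Rightarrow> bool" where
  const: "U_homogeneous 0 (U_const z)"
| gen: "A \<in> pauli_component g \<Longrightarrow> U_homogeneous g (U_emb A)"
| add: "U_homogeneous g u \<Longrightarrow> U_homogeneous g v \<Longrightarrow> U_homogeneous g (u \<oplus>\<^bsub>Usl2\<^esub> v)"
| mult: "U_homogeneous g u \<Longrightarrow> U_homogeneous g' v \<Longrightarrow>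
    U_homogeneous (g + g') (u \<otimes>\<^bsub>Usl2\<^esub> v)"

definition U_component :: "Z2sq \<Rightarrow> U_elt set" where
  "U_component g = {u. U_homogeneous g u}"

definition casimir :: U_elt where
  "casimir =
    (U_emb sl2_h \<oplus>\<^bsub>Usl2\<^esub> \<one>\<^bsub>Usl2\<^esub>) [^]\<^bsub>Usl2\<^esub> (2::nat) \<oplus>\<^bsub>Usl2\<^esub>
    U_const 4 \<otimes>\<^bsub>Usl2\<^esub> (U_emb sl2_y \<otimes>\<^bsub>Usl2\<^esub> U_emb sl2_x)"

definition I_ideal :: "complex \<Rightarrow> U_elt set" where
  "I_ideal lam = genideal Usl2 {casimir \<ominus>\<^bsub>Usl2\<^esub> U_const ((lam + 1)\<^sup>2)}"

definition UI :: "complex \<Rightarrow> U_elt set ring" where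
  "UI lam = Usl2 Quot I_ideal lam"

definition UI_proj :: "complex \<Rightarrow> U_elt \<Rightarrow> U_elt set" where
  "UI_proj lam u = I_ideal lam +>\<^bsub>Usl2\<^esub> u"

section \<open>Modules\<close>

text \<open>The locale \<^locale>\<open>module\<close> requires a commutative ring of scalars. An
  \<open>\<ss>\<ll>\<^sub>2(\<complex>)\<close>-module is a left module over \<^const>\<open>Usl2\<close>; in particular its submodules are
  complex subspaces, as \<^const>\<open>Usl2\<close> contains the scalars.\<close>

locale left_module = R?: ring R + M?: abelian_group M
  for R :: "('a, 'm) ring_scheme" and M :: "('a, 'b, 'n) module_scheme" (structure) +
  assumes smult_closed:
      "\<lbrakk>a \<in> carrier R; x \<in> carrier M\<rbrakk> \<Longrightarrow> a \<odot>\<^bsub>M\<^esub> x \<in> carrier M"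
    and smult_l_distr:
      "\<lbrakk>a \<in> carrier R; b \<in> carrier R; x \<in> carrier M\<rbrakk> \<Longrightarrow>
      (a \<oplus>\<^bsub>R\<^esub> b) \<odot>\<^bsub>M\<^esub> x = a \<odot>\<^bsub>M\<^esub> x \<oplus>\<^bsub>M\<^esub> b \<odot>\<^bsub>M\<^esub> x"
    and smult_r_distr:
      "\<lbrakk>a \<in> carrier R; x \<in> carrier M; y \<in> carrier M\<rbrakk> \<Longrightarrow>
      a \<odot>\<^bsub>M\<^esub> (x \<oplus>\<^bsub>M\<^esub> y) = a \<odot>\<^bsub>M\<^esub> x \<oplus>\<^bsub>M\<^esub> a \<odot>\<^bsub>M\<^esub> y"
    and smult_assoc:
      "\<lbrakk>a \<in> carrier R; b \<in> carrier R; x \<in> carrier M\<rbrakk> \<Longrightarrow>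
      (a \<otimes>\<^bsub>R\<^esub> b) \<odot>\<^bsub>M\<^esub> x = a \<odot>\<^bsub>M\<^esub> (b \<odot>\<^bsub>M\<^esub> x)"
    and smult_one:
      "x \<in> carrier M \<Longrightarrow> \<one>\<^bsub>R\<^esub> \<odot>\<^bsub>M\<^esub> x = x"

definition maximal_submodule :: "'b set \<Rightarrow> 'a ring \<Rightarrow> ('a, 'b) module \<Rightarrow> bool" where
  "maximal_submodule N R M \<longleftrightarrow>
    submodule N R M \<and> N \<noteq> carrier M \<and>
    (\<forall>W. submodule W R M \<and> N \<subseteq> W \<and> W \<noteq> carrier M \<longrightarrow> W = N)"

subsection \<open>Graded modules\<close>

definition internal_direct_sum ::
    "(U_elt, 'b) module \<Rightarrow> (Z2sq \<Rightarrow> 'b set) \<Rightarrow> 'b set \<Rightarrow> bool" where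
  "internal_direct_sum M \<Gamma> W \<longleftrightarrow>
    (\<forall>g. subgroup (\<Gamma> g) (add_monoid M)) \<and>
    (\<forall>g z. \<forall>m\<in>\<Gamma> g. U_const z \<odot>\<^bsub>M\<^esub> m \<in> \<Gamma> g) \<and>
    (\<forall>f\<in>(\<Pi> g\<in>UNIV. \<Gamma> g). (\<Oplus>\<^bsub>M\<^esub>g\<in>UNIV. f g) \<in> W) \<and>
    (\<forall>w\<in>W. \<exists>!f. f \<in> (\<Pi> g\<in>UNIV. \<Gamma> g) \<and> w = (\<Oplus>\<^bsub>M\<^esub>g\<in>UNIV. f g))"

definition graded_module :: "(U_elt, 'b) module \<Rightarrow> (Z2sq \<Rightarrow> 'b set) \<Rightarrow> bool" where
  "graded_module M \<Gamma> \<longleftrightarrow>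
    left_module Usl2 M \<and> internal_direct_sum M \<Gamma> (carrier M) \<and>
    (\<forall>g g'. \<forall>A\<in>pauli_component g. \<forall>m\<in>\<Gamma> g'. U_emb A \<odot>\<^bsub>M\<^esub> m \<in> \<Gamma> (g + g'))"

definition graded_submodule ::
    "'b set \<Rightarrow> (U_elt, 'b) module \<Rightarrow> (Z2sq \<Rightarrow> 'b set) \<Rightarrow> bool" where
  "graded_submodule W M \<Gamma> \<longleftrightarrow>
    submodule W Usl2 M \<and> internal_direct_sum M (\<lambda>g. W \<inter> \<Gamma> g) W"

definition graded_simple :: "(U_elt, 'b) module \<Rightarrow> (Z2sq \<Rightarrow> 'b set) \<Rightarrow> bool" where
  "graded_simple M \<Gamma> \<longleftrightarrow>
    graded_module M \<Gamma> \<and>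
    (\<forall>W. graded_submodule W M \<Gamma> \<longrightarrow> W = {\<zero>\<^bsub>M\<^esub>} \<or> W = carrier M)"

section \<open>The module and its maximal submodule\<close>

definition C_left_ideal :: "complex \<Rightarrow> U_elt set set" where
  "C_left_ideal lam = {a \<otimes>\<^bsub>UI lam\<^esub> UI_proj lam (U_emb sl2_C) | a. a \<in> carrier (UI lam)}"

text \<open>The fields \<^const>\<open>mult\<close> and \<^const>\<open>one\<close> of the record are irrelevant for a module. The union
  in the action ranges over the representatives \<open>b\<close> of the coset \<open>m\<close>, as in
  \<^const>\<open>rcoset_mult\<close>; all of them yield the same coset.\<close>

definition M_C :: "complex \<Rightarrow> (U_elt, U_elt set set) module" where
  "M_C lam =
    \<lparr>carrier = a_rcosets\<^bsub>UI lam\<^esub> (C_left_ideal lam),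
     mult = undefined, one = undefined,
     ring.zero = C_left_ideal lam,
     add = set_add (UI lam),
     smult = (\<lambda>u m. \<Union>b\<in>m. C_left_ideal lam +>\<^bsub>UI lam\<^esub> (UI_proj lam u \<otimes>\<^bsub>UI lam\<^esub> b))\<rparr>"

definition M_C_component :: "complex \<Rightarrow> Z2sq \<Rightarrow> U_elt set set set" where
  "M_C_component lam g =
    {C_left_ideal lam +>\<^bsub>UI lam\<^esub> UI_proj lam u | u. u \<in> U_component g}"

text \<open>For even integers \<open>lam\<close> there is exactly one maximal submodule, so that the description is
  proper.\<close>

definition N_C :: "complex \<Rightarrow> U_elt set set set" where
  "N_C lam = (THE N. maximal_submodule N Usl2 (M_C lam))"

definition N_C_module :: "complex \<Rightarrow> (U_elt, U_elt set set) module" where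
  "N_C_module lam = (M_C lam)\<lparr>carrier := N_C lam\<rparr>"

definition N_C_component :: "complex \<Rightarrow> Z2sq \<Rightarrow> U_elt set set set" where
  "N_C_component lam g = N_C lam \<inter> M_C_component lam g"

end

theory Submission
  imports Defs
begin

text \<open>Over the complex numbers \<open>C\<close> is conjugate to a multiple of \<open>h\<close>: with \<open>E = (h + iB)/2\<close>,
  \<open>F = (h - iB)/2\<close> and \<open>H = -iC\<close> one has \<open>[E,F] = H\<close>, \<open>[H,E] = 2E\<close>, \<open>[H,F] = -2F\<close>, so that
  \<open>M\<close> has a basis of \<open>H\<close>-weight vectors \<open>v\<^sub>k\<close> of weight \<open>2k\<close>, \<open>k \<in> \<int>\<close>, where \<open>v\<^sub>0\<close> is the class of 1,
  \<open>v\<^sub>k = E\<^sup>k v\<^sub>0\<close> and \<open>v\<^sub>-\<^sub>k = F\<^sup>k v\<^sub>0\<close> for \<open>k \<ge> 0\<close>.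
  Choose \<open>m \<ge> 0\<close> with \<open>(\<lambda> + 1)\<^sup>2 = (2m + 1)\<^sup>2\<close>. The Casimir relation gives \<open>FE v\<^sub>k = (m - k)(m + k + 1) v\<^sub>k\<close>, so the
  only transitions that vanish are those from \<open>\<bar>k\<bar> = m + 1\<close> to \<open>\<bar>k\<bar> = m\<close>: a submodule containing a
  weight \<open>\<bar>k\<bar> \<le> m\<close> is everything, and the \<open>v\<^sub>k\<close> with \<open>\<bar>k\<bar> > m\<close> span the maximal submodule, the sum of a
  lowest and a highest weight module. The grading is the joint eigenspace decomposition for
  \<open>v\<^sub>k \<mapsto> (-1)\<^sup>k v\<^sub>k\<close> and \<open>v\<^sub>k \<mapsto> v\<^sub>-\<^sub>k\<close>. A graded submodule is stable under the second map, which swaps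
  the two summands.\<close>

section \<open>The weight space and its raising and lowering operators\<close>

abbreviation lookup :: "('a \<Rightarrow>\<^sub>0 'b::zero) \<Rightarrow> 'a \<Rightarrow> 'b" where "lookup \<equiv> Poly_Mapping.lookup"

type_synonym weight_space = "int \<Rightarrow>\<^sub>0 complex"

text \<open>All operators of the model are instances of this one, so that finiteness of the support
  is checked only once. It requires \<open>s\<close> to be injective; otherwise a finite support can
  have an infinite preimage.\<close>

definition weighted_shift :: "(int \<Rightarrow> complex) \<Rightarrow> (int \<Rightarrow> int) \<Rightarrow> weight_space \<Rightarrow> weight_space" where
  "weighted_shift c s f = Abs_poly_mapping (\<lambda>k. c k * lookup f (s k))"

lemma lookup_weighted_shift:
  assumes "inj s"
  shows "lookup (weighted_shift c s f) k = c k * lookup f (s k)"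
proof -
  have "{k. c k * lookup f (s k) \<noteq> 0} \<subseteq> s -` Poly_Mapping.keys f"
    by (auto simp: in_keys_iff)
  then have "finite {k. c k * lookup f (s k) \<noteq> 0}"
    by (rule finite_subset) (simp add: finite_vimageI assms)
  then show ?thesis
    by (simp add: weighted_shift_def)
qed

definition scale :: "complex \<Rightarrow> weight_space \<Rightarrow> weight_space" where
  "scale z = weighted_shift (\<lambda>_. z) id"

lemma lookup_scale [simp]: "lookup (scale z f) k = z * lookup f k"
  by (simp add: scale_def lookup_weighted_shift)

definition reflect :: "weight_space \<Rightarrow> weight_space" where
  "reflect = weighted_shift (\<lambda>_. 1) uminus"

lemma lookup_reflect [simp]: "lookup (reflect f) k = lookup f (- k)"
  by (simp add: reflect_def lookup_weighted_shift)

definition restrict_weights :: "int set \<Rightarrow> weight_space \<Rightarrow> weight_space" where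
  "restrict_weights S = weighted_shift (\<lambda>k. if k \<in> S then 1 else 0) id"

lemma lookup_restrict_weights [simp]:
  "lookup (restrict_weights S f) k = (if k \<in> S then lookup f k else 0)"
  by (simp add: restrict_weights_def lookup_weighted_shift)

definition delta :: "int \<Rightarrow> weight_space" where
  "delta k = Poly_Mapping.single k 1"

lemma lookup_delta [simp]: "lookup (delta k) j = (if j = k then 1 else 0)"
  by (simp add: delta_def lookup_single when_def)

lemmas lookup_linear [simp] = lookup_add lookup_minus

lemma weight_space_expansion: "f = (\<Sum>k\<in>Poly_Mapping.keys f. scale (lookup f k) (delta k))"
  by (rule poly_mapping_eqI) (auto simp: lookup_sum in_keys_iff if_distrib[of "(*) _"] sum.delta cong: if_cong)

lemma scale_simps [simp]:
  "scale z 0 = 0" "scale 0 f = 0" "scale 1 f = f" "scale z (scale w f) = scale (z * w) f"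
  by (rule poly_mapping_eqI, simp)+

lemma scale_distrib:
  "scale z (f + g) = scale z f + scale z g" "scale (z + w) f = scale z f + scale w f"
  by (rule poly_mapping_eqI, simp add: algebra_simps)+

lemma scale_sum: "scale z (sum f I) = (\<Sum>i\<in>I. scale z (f i))"
  by (rule poly_mapping_eqI) (simp add: lookup_sum sum_distrib_left)

definition linear_op :: "(weight_space \<Rightarrow> weight_space) \<Rightarrow> bool" where
  "linear_op T \<longleftrightarrow> (\<forall>f g. T (f + g) = T f + T g) \<and> (\<forall>z f. T (scale z f) = scale z (T f))"

lemma linear_op_weighted_shift: "inj s \<Longrightarrow> linear_op (weighted_shift c s)"
  by (auto simp: linear_op_def lookup_weighted_shift algebra_simps intro!: poly_mapping_eqI)

text \<open>The scalar by which \<open>FE\<close> acts on \<open>v\<^sub>k\<close> if the Casimir element acts by \<open>(2m + 1)\<^sup>2\<close>.\<close>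

definition fe_scalar :: "int \<Rightarrow> int \<Rightarrow> complex" where
  "fe_scalar m k = of_int ((m - k) * (m + k + 1))"

text \<open>The scalar in E v_k = \<open>up_coeff m k\<close> v_(k+1). For k \<ge> 0 the vector
  v_(k+1) is E v_k by choice of the basis; for k < 0 one has v_k = F v_(k+1), and EF = FE + H gives
  the scalar \<open>fe_scalar m k\<close>.\<close>

definition up_coeff :: "int \<Rightarrow> int \<Rightarrow> complex" where
  "up_coeff m k = (if k \<ge> 0 then 1 else fe_scalar m k)"

definition E_op :: "int \<Rightarrow> weight_space \<Rightarrow> weight_space" where
  "E_op m = weighted_shift (\<lambda>k. up_coeff m (k - 1)) (\<lambda>k. k - 1)"

text \<open>The mirror image of \<open>E_op\<close> under k \<mapsto> -k: F sends v_j to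
  \<open>up_coeff m (- j)\<close> times v_(j-1), and the coefficient at k comes from j = k +
  1.\<close>

definition F_op :: "int \<Rightarrow> weight_space \<Rightarrow> weight_space" where
  "F_op m = weighted_shift (\<lambda>k. up_coeff m (- k - 1)) (\<lambda>k. k + 1)"

definition H_op :: "weight_space \<Rightarrow> weight_space" where
  "H_op = weighted_shift (\<lambda>k. 2 * of_int k) id"

lemma inj_shift [simp]: "inj (\<lambda>k::int. k - 1)" "inj (\<lambda>k::int. k + 1)"
  by (auto simp: inj_def)

lemma lookup_ops [simp]:
  "lookup (E_op m f) k = up_coeff m (k - 1) * lookup f (k - 1)"
  "lookup (F_op m f) k = up_coeff m (- k - 1) * lookup f (k + 1)"
  "lookup (H_op f) k = 2 * of_int k * lookup f k"
  by (simp_all add: E_op_def F_op_def H_op_def lookup_weighted_shift)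

lemma linear_ops: "linear_op (E_op m)" "linear_op (F_op m)" "linear_op H_op" "linear_op (scale z)"
  "linear_op reflect" "linear_op (restrict_weights S)"
  by (simp_all add: E_op_def F_op_def H_op_def scale_def reflect_def restrict_weights_def linear_op_weighted_shift)

text \<open>The substitution exchanges the factors m - k and m + k + 1.\<close>

lemma fe_scalar_reflect: "fe_scalar m (- k - 1) = fe_scalar m k"
  by (simp add: fe_scalar_def algebra_simps)

text \<open>Exactly one of k and -k - 1 is negative, so one factor is 1 and the other is
  \<open>fe_scalar\<close>, possibly at the mirrored argument. This makes FE and EF
  diagonal.\<close>

lemma up_coeff_mult: "up_coeff m k * up_coeff m (- k - 1) = fe_scalar m k"
  using fe_scalar_reflect[of m k] by (auto simp: up_coeff_def)

lemma FE_op: "lookup (F_op m (E_op m f)) k = fe_scalar m k * lookup f k"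
  using up_coeff_mult[of m k] by (simp add: mult.assoc[symmetric]) (simp add: mult.commute)

lemma EF_op: "lookup (E_op m (F_op m f)) k = fe_scalar m (k - 1) * lookup f k"
  using up_coeff_mult[of m "k - 1"] by (simp add: mult.assoc[symmetric])

lemma fe_scalar_diff: "fe_scalar m (k - 1) - fe_scalar m k = 2 * of_int k"
  by (simp add: fe_scalar_def algebra_simps)

text \<open>The first identity is the difference equation \<open>fe_scalar_diff\<close>; the other
  two hold because E and F shift the index by one and H has eigenvalue 2k.\<close>

lemma op_commutators:
  "E_op m (F_op m f) = F_op m (E_op m f) + H_op f"
  "H_op (E_op m f) = E_op m (H_op f) + scale 2 (E_op m f)"
  "H_op (F_op m f) = F_op m (H_op f) - scale 2 (F_op m f)"
proof -
  show "E_op m (F_op m f) = F_op m (E_op m f) + H_op f"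
  proof (rule poly_mapping_eqI)
    fix k
    show "lookup (E_op m (F_op m f)) k = lookup (F_op m (E_op m f) + H_op f) k"
      unfolding lookup_linear EF_op FE_op using fe_scalar_diff[of m k]
      by (simp add: algebra_simps flip: distrib_right)
  qed
qed (rule poly_mapping_eqI, simp add: algebra_simps)+

section \<open>The action of traceless matrices on the weight space\<close>

text \<open>The coefficients come from \<open>h = E + F\<close>, \<open>B = -i(E - F)\<close>, \<open>C = iH\<close>; the entry \<open>A$2$2\<close> is
  determined by the trace.\<close>

definition mat_op :: "int \<Rightarrow> complex^2^2 \<Rightarrow> weight_space \<Rightarrow> weight_space" where
  "mat_op m A f =
    scale (A$1$1 - \<i> * (A$1$2 + A$2$1) / 2) (E_op m f) +
    scale (A$1$1 + \<i> * (A$1$2 + A$2$1) / 2) (F_op m f) +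
    scale (\<i> * (A$1$2 - A$2$1) / 2) (H_op f)"

lemma linear_op_mat_op: "linear_op (mat_op m A)"
  using linear_ops(1,2)[of m] linear_ops(3)
  by (auto simp: mat_op_def linear_op_def scale_distrib algebra_simps)

lemma mat_op_add: "mat_op m (A + B) f = mat_op m A f + mat_op m B f"
  by (rule poly_mapping_eqI) (simp add: mat_op_def field_simps)

lemma mat_op_scale: "mat_op m (mat_scale z A) f = scale z (mat_op m A f)"
  by (rule poly_mapping_eqI) (simp add: mat_op_def mat_scale_def field_simps)

lemma mat_op_zero: "mat_op m A 0 = 0"
  by (rule poly_mapping_eqI) (simp add: mat_op_def)

text \<open>The commutator is bilinear in the coefficients of E, F, H, so
  \<open>op_commutators\<close> determines it. Tracelessness enters because the matrix product
  involves the entries \<open>A$2$2\<close> and \<open>B$2$2\<close>, which \<open>mat_op\<close>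
  does not see.\<close>

lemma mat_op_bracket:
  assumes "A \<in> sl2" "B \<in> sl2"
  shows "mat_op m (lie_bracket A B) f = mat_op m A (mat_op m B f) - mat_op m B (mat_op m A f)"
proof -
  have A: "A$2$2 = - A$1$1" and B: "B$2$2 = - B$1$1"
    using assms by (simp_all add: sl2_def trace_def UNIV_2 add_eq_0_iff)
  note lin = linear_ops(1,2)[of m, unfolded linear_op_def] linear_ops(3)[unfolded linear_op_def]
  define u v w where "u = A$1$1 - \<i> * (A$1$2 + A$2$1) / 2" "v = A$1$1 + \<i> * (A$1$2 + A$2$1) / 2"
    "w = \<i> * (A$1$2 - A$2$1) / 2"
  define u' v' w' where "u' = B$1$1 - \<i> * (B$1$2 + B$2$1) / 2" "v' = B$1$1 + \<i> * (B$1$2 + B$2$1) / 2"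
    "w' = \<i> * (B$1$2 - B$2$1) / 2"
  have "mat_op m A (mat_op m B f) - mat_op m B (mat_op m A f) =
    scale (2 * (w * u' - u * w')) (E_op m f) + scale (2 * (v * w' - w * v')) (F_op m f)
    + scale (u * v' - v * u') (H_op f)"
    unfolding mat_op_def u_v_w_def[symmetric] u'_v'_w'_def[symmetric]
    by (simp add: lin scale_distrib op_commutators)
      (rule poly_mapping_eqI, simp add: algebra_simps)
  also have "\<dots> = mat_op m (lie_bracket A B) f"
  proof -
    have "2 * (w * u' - u * w') = lie_bracket A B$1$1 - \<i> * (lie_bracket A B$1$2 + lie_bracket A B$2$1) / 2"
      "2 * (v * w' - w * v') = lie_bracket A B$1$1 + \<i> * (lie_bracket A B$1$2 + lie_bracket A B$2$1) / 2"
      "u * v' - v * u' = \<i> * (lie_bracket A B$1$2 - lie_bracket A B$2$1) / 2"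
      unfolding u_v_w_def u'_v'_w'_def lie_bracket_def
      by (simp_all add: matrix_matrix_mult_def UNIV_2 A B field_simps)
    then show ?thesis by (simp only: mat_op_def)
  qed
  finally show ?thesis by simp
qed

section \<open>Representation of the free algebra\<close>

abbreviation "FA \<equiv> free_algebra sl2"

lemma FA_simps [simp]:
  "mult FA = (*)" "one FA = 1" "ring.zero FA = 0" "add FA = (+)"
  by (simp_all add: free_algebra_def)

interpretation FA: ring FA by (rule ring_free_algebra)

lemma nc_const_simps:
  "nc_const 0 = 0" "nc_const 1 = 1" "nc_const (z + w) = nc_const z + nc_const w"
  "nc_const (z - w) = nc_const z - nc_const w" "nc_const (- z) = - nc_const z"
  "nc_const (z * w) = nc_const z * nc_const w"
  by (simp_all add: nc_const_def single_add single_diff single_uminus mult_single)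

lemma nc_const_numeral: "nc_const (numeral n) = numeral n"
  by (simp add: nc_const_def)

text \<open>The single case is restricted to words occurring in \<open>p\<close>, so that in
  \<open>FA_induct\<close> their letters are known to be traceless.\<close>

lemma ncpoly_induct [case_names zero single add]:
  fixes p :: "'a ncpoly"
  assumes "P 0" "\<And>w z. w \<in> Poly_Mapping.keys p \<Longrightarrow> P (Poly_Mapping.single w z)"
    "\<And>p q. P p \<Longrightarrow> P q \<Longrightarrow> P (p + q)"
  shows "P p"
proof -
  have P: "P (\<Sum>w\<in>S. Poly_Mapping.single w (lookup p w))" if "finite S" "S \<subseteq> Poly_Mapping.keys p" for S
    using that by (induction S rule: finite_induct) (auto simp: assms)
  have eq: "p = (\<Sum>w\<in>Poly_Mapping.keys p. Poly_Mapping.single w (lookup p w))"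
    by (rule poly_mapping_eqI) (auto simp: lookup_sum lookup_single when_def in_keys_iff)
  show ?thesis using P[OF finite_keys order_refl] eq by simp
qed

lemma nc_const_commute: "nc_const z * p = p * nc_const z"
proof (induction p rule: ncpoly_induct)
  case (single w z')
  then show ?case by (simp add: nc_const_def mult_single mult.commute)
qed (simp_all add: distrib_left distrib_right)

lemma nc_var_carrier [simp]: "A \<in> sl2 \<Longrightarrow> nc_var A \<in> carrier FA"
  and nc_const_carrier [simp]: "nc_const z \<in> carrier FA"
  by (simp_all add: free_algebra_def nc_var_def nc_const_def zero_word_def)

lemma FA_closed [simp]:
  "a \<in> carrier FA \<Longrightarrow> b \<in> carrier FA \<Longrightarrow> a + b \<in> carrier FA"
  "a \<in> carrier FA \<Longrightarrow> b \<in> carrier FA \<Longrightarrow> a * b \<in> carrier FA"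
  "0 \<in> carrier FA" "1 \<in> carrier FA"
  "a \<in> carrier FA \<Longrightarrow> - a \<in> carrier FA"
  "a \<in> carrier FA \<Longrightarrow> b \<in> carrier FA \<Longrightarrow> a - b \<in> carrier FA"
proof -
  show "0 \<in> carrier FA" "1 \<in> carrier FA"
    using FA.zero_closed FA.one_closed unfolding FA_simps .
  show "- a \<in> carrier FA" if "a \<in> carrier FA"
    using that by (simp add: free_algebra_def)
  show add: "a + b \<in> carrier FA" and "a * b \<in> carrier FA" if "a \<in> carrier FA" "b \<in> carrier FA" for a b
    using FA.a_closed[OF that] FA.m_closed[OF that] unfolding FA_simps .
  show "a - b \<in> carrier FA" if "a \<in> carrier FA" "b \<in> carrier FA"
    using that Poly_Mapping.keys_diff[of a b] by (force simp: free_algebra_def)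
qed

lemma FA_minus [simp]:
  assumes "b \<in> carrier FA"
  shows "a_inv FA b = - b" and "a_minus FA a b = a - b"
proof -
  show "a_inv FA b = - b"
    using assms by (intro FA.minus_equality) simp_all
  then show "a_minus FA a b = a - b"
    by (simp add: a_minus_def)
qed

lemma FA_induct [consumes 1, case_names const var add mult]:
  assumes "a \<in> carrier FA"
    and const: "\<And>z. P (nc_const z)" and var: "\<And>A. A \<in> sl2 \<Longrightarrow> P (nc_var A)"
    and add: "\<And>a b. a \<in> carrier FA \<Longrightarrow> b \<in> carrier FA \<Longrightarrow> P a \<Longrightarrow> P b \<Longrightarrow> P (a + b)"
    and mult: "\<And>a b. a \<in> carrier FA \<Longrightarrow> b \<in> carrier FA \<Longrightarrow> P a \<Longrightarrow> P b \<Longrightarrow> P (a * b)"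
  shows "P a"
proof -
  have word: "Poly_Mapping.single (Word l) 1 \<in> carrier FA \<and> P (Poly_Mapping.single (Word l) 1)"
    if "set l \<subseteq> sl2" for l
    using that
  proof (induction l)
    case Nil
    then show ?case
      using const[of 1] FA_closed(4) by (simp add: nc_const_def flip: zero_word_def)
  next
    case (Cons A l)
    have "Poly_Mapping.single (Word (A # l)) 1 = nc_var A * Poly_Mapping.single (Word l) (1::complex)"
      by (simp add: nc_var_def mult_single plus_word_def)
    with Cons show ?case
      by (auto intro!: mult var simp del: FA_closed simp: FA_closed(2))
  qed
  have "a \<in> carrier FA \<and> P a"
  proof (induction a rule: ncpoly_induct)
    case (single w z)
    then have "set (letters w) \<subseteq> sl2"
      using assms(1) by (simp add: free_algebra_def)
    then have w: "Poly_Mapping.single w 1 \<in> carrier FA" "P (Poly_Mapping.single w 1)"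
      using word[of "letters w"] by simp_all
    have "Poly_Mapping.single w z = nc_const z * Poly_Mapping.single w 1"
      by (simp add: nc_const_def mult_single)
    then show ?case
      using w mult[OF nc_const_carrier w(1) const w(2)] by (simp only: FA_closed(2) nc_const_carrier)
  next
    case zero
    then show ?case using const[of 0] by (simp add: nc_const_simps)
  qed (use add in auto)
  then show ?thesis ..
qed

lemma linear_op_zero: "linear_op T \<Longrightarrow> T 0 = 0"
  by (metis linear_op_def scale_simps(2))

text \<open>The linear extension of \<open>mat_op\<close> to words, where the last letter acts
  first.\<close>

definition rep :: "int \<Rightarrow> (complex^2^2) ncpoly \<Rightarrow> weight_space \<Rightarrow> weight_space" where
  "rep m p f = (\<Sum>w\<in>Poly_Mapping.keys p. scale (lookup p w) (foldr (mat_op m) (letters w) f))"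

lemma linear_op_foldr: "linear_op (foldr (mat_op m) l)"
  using linear_op_mat_op[of m] by (induction l) (simp_all add: linear_op_def)

lemma linear_op_rep: "linear_op (rep m p)"
  using linear_op_foldr[of m]
  by (simp add: linear_op_def rep_def scale_distrib scale_sum sum.distrib mult.commute)

text \<open>Sums over different supports can be compared after passing to a common index
  set.\<close>

lemma rep_superset:
  assumes "finite S" "Poly_Mapping.keys p \<subseteq> S"
  shows "rep m p f = (\<Sum>w\<in>S. scale (lookup p w) (foldr (mat_op m) (letters w) f))"
  unfolding rep_def using assms by (intro sum.mono_neutral_left) (auto simp: in_keys_iff)

lemma rep_add: "rep m (p + q) f = rep m p f + rep m q f"
proof -
  let ?S = "Poly_Mapping.keys p \<union> Poly_Mapping.keys q"
  have "rep m r f = (\<Sum>w\<in>?S. scale (lookup r w) (foldr (mat_op m) (letters w) f))"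
    if "r \<in> {p, q, p + q}" for r
    using that Poly_Mapping.keys_add[of p q] by (intro rep_superset) auto
  then show ?thesis by (simp add: scale_distrib sum.distrib)
qed

lemma rep_single: "rep m (Poly_Mapping.single w z) f = scale z (foldr (mat_op m) (letters w) f)"
  using rep_superset[of "{w}" "Poly_Mapping.single w z" m f] by (simp split: if_splits)

lemma rep_const [simp]: "rep m (nc_const z) f = scale z f"
  by (simp add: nc_const_def rep_single zero_word_def)

lemma rep_zero [simp]: "rep m 0 f = 0" and rep_one [simp]: "rep m 1 f = f"
  using rep_const[of m 0 f] rep_const[of m 1 f] by (simp_all add: nc_const_simps)

lemma rep_diff: "rep m (p - q) f = rep m p f - rep m q f"
  using rep_add[of m "p - q" q f] by simp

lemma rep_var [simp]: "rep m (nc_var A) f = mat_op m A f"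
  by (simp add: nc_var_def rep_single)

text \<open>Bilinearity reduces the claim to two words, for which folding over a concatenation is
  composition.\<close>

lemma rep_mult: "rep m (p * q) f = rep m p (rep m q f)"
proof (induction p rule: ncpoly_induct)
  case (single w z)
  show ?case
  proof (induction q rule: ncpoly_induct)
    case (single w' z')
    then show ?case
      using linear_op_foldr[of m "letters w"]
      by (simp add: mult_single rep_single plus_word_def linear_op_def)
  next
    case zero
    then show ?case
      using linear_op_zero[OF linear_op_rep, of m "Poly_Mapping.single w z"] by simp
  next
    case (add q q')
    then show ?case
      using linear_op_rep[of m "Poly_Mapping.single w z"]
      by (simp add: distrib_left rep_add linear_op_def)
  qed
qed (simp_all add: distrib_right rep_add)

section \<open>The Casimir element and the kernel of the representation\<close>

definition casimir_lift :: "(complex^2^2) ncpoly" where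
  "casimir_lift = (nc_var sl2_h + 1) * (nc_var sl2_h + 1) + nc_const 4 * (nc_var sl2_y * nc_var sl2_x)"

lemma sl2_entries [simp]:
  "sl2_h$1$1 = 1" "sl2_h$1$2 = 0" "sl2_h$2$1 = 0" "sl2_h$2$2 = -1"
  "sl2_x$1$1 = 0" "sl2_x$1$2 = 1" "sl2_x$2$1 = 0" "sl2_x$2$2 = 0"
  "sl2_y$1$1 = 0" "sl2_y$1$2 = 0" "sl2_y$2$1 = 1" "sl2_y$2$2 = 0"
  by (simp_all add: sl2_h_def sl2_x_def sl2_y_def)

lemma sl2_iff: "A \<in> sl2 \<longleftrightarrow> A$2$2 = - A$1$1"
  by (auto simp: sl2_def trace_def UNIV_2 add_eq_0_iff)

lemma sl2_generators [simp]: "sl2_h \<in> sl2" "sl2_x \<in> sl2" "sl2_y \<in> sl2" "sl2_B \<in> sl2" "sl2_C \<in> sl2"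
  by (simp_all add: sl2_iff sl2_B_def sl2_C_def)

text \<open>In terms of E, F, H the Casimir element is 4FE + (H + 1)^2. On v_k it acts by 4(m - k)(m
  + k + 1) + (2k + 1)^2, which equals (2m + 1)^2 for every k.\<close>

lemma rep_casimir: "rep m casimir_lift f = scale ((2 * of_int m + 1)\<^sup>2) f"
proof -
  note lin = linear_ops(1,2)[of m, unfolded linear_op_def] linear_ops(3)[unfolded linear_op_def]
  have h: "mat_op m sl2_h f = E_op m f + F_op m f" for f
    by (simp add: mat_op_def)
  have x: "mat_op m sl2_x f = scale (1/2) (scale (- \<i>) (E_op m f) + scale \<i> (F_op m f) + scale \<i> (H_op f))" for f
    by (simp add: mat_op_def scale_distrib)
  have y: "mat_op m sl2_y f = scale (1/2) (scale (- \<i>) (E_op m f) + scale \<i> (F_op m f) + scale (- \<i>) (H_op f))" for f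
    by (simp add: mat_op_def scale_distrib)
  have "rep m casimir_lift f = scale 4 (F_op m (E_op m f)) + scale 2 (H_op f) + H_op (H_op f) + f"
    unfolding casimir_lift_def
    \<comment> \<open>The commutators, read from left to right, sort every product into the order F,
      E, H.\<close>
    apply (simp only: rep_add rep_mult rep_one rep_var rep_const h x y lin scale_distrib scale_simps op_commutators)
    apply (rule poly_mapping_eqI)
    apply (simp only: lookup_linear lookup_scale)
    apply (simp del: lookup_ops add: field_simps)
    done
  also have "\<dots> = scale ((2 * of_int m + 1)\<^sup>2) f"
    by (rule poly_mapping_eqI)
      (simp only: lookup_linear FE_op lookup_scale lookup_ops(3),
        simp add: fe_scalar_def algebra_simps power2_eq_square)
  finally show ?thesis .
qed

definition rep_kernel :: "int \<Rightarrow> (complex^2^2) ncpoly set" where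
  "rep_kernel m = {a \<in> carrier FA. \<forall>f. rep m a f = 0}"

lemma ideal_rep_kernel: "ideal (rep_kernel m) FA"
proof (rule idealI)
  show "subgroup (rep_kernel m) (add_monoid FA)"
  proof (rule FA.add.subgroupI)
    have "0 \<in> rep_kernel m" by (simp add: rep_kernel_def)
    then show "rep_kernel m \<noteq> {}" by blast
    show "rep_kernel m \<subseteq> carrier FA" by (auto simp: rep_kernel_def)
    show "a_inv FA a \<in> rep_kernel m" if "a \<in> rep_kernel m" for a
      using that rep_diff[of m 0 a] by (simp add: rep_kernel_def)
    show "add FA a b \<in> rep_kernel m" if "a \<in> rep_kernel m" "b \<in> rep_kernel m" for a b
      using that by (simp add: rep_kernel_def rep_add)
  qed
  show "ring FA" by (rule ring_free_algebra)
  show "mult FA x a \<in> rep_kernel m" "mult FA a x \<in> rep_kernel m"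
    if "a \<in> rep_kernel m" "x \<in> carrier FA" for a x
    using that by (simp_all add: rep_kernel_def rep_mult linear_op_zero[OF linear_op_rep])
qed

text \<open>The three families of relations are additivity, homogeneity and bracket compatibility of
  \<open>mat_op\<close>. Hence the action descends to the enveloping algebra.\<close>

lemma sl2_ideal_le_rep_kernel: "sl2_ideal \<subseteq> rep_kernel m"
  unfolding sl2_ideal_def
proof (rule FA.genideal_minimal[OF ideal_rep_kernel])
  show "sl2_relations \<subseteq> rep_kernel m"
  proof
    fix r assume r: "r \<in> sl2_relations"
    then have "rep m r f = 0" for f
      by (auto simp: sl2_relations_def rep_diff rep_mult mat_op_add mat_op_scale mat_op_bracket)
    with r show "r \<in> rep_kernel m"
      using sl2_relations_subset by (auto simp: rep_kernel_def)
  qed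
qed

section \<open>Cosets in the quotient of the enveloping algebra\<close>

lemma (in abelian_group) a_coset_eq_iff:
  assumes "subgroup H (add_monoid G)" "x \<in> carrier G" "y \<in> carrier G"
  shows "H +> x = H +> y \<longleftrightarrow> x \<ominus> y \<in> H"
proof -
  have H: "H \<subseteq> carrier G" using subgroup.subset[OF assms(1)] by simp
  have "H +> x = H +> y \<longleftrightarrow> H +> (x \<oplus> \<ominus> y) = H"
    using a_coset_add_inv1[OF _ assms(2,3) H] a_coset_add_inv2[OF _ assms(2,3) H] by metis
  also have "\<dots> \<longleftrightarrow> x \<oplus> \<ominus> y \<in> H"
    using a_coset_join1[OF _ _ assms(1)] a_coset_join2[OF _ assms(1)] assms(2,3) a_inv_closed a_closed
    by metis
  finally show ?thesis unfolding a_minus_def .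
qed

interpretation Usl2: ring Usl2 by (rule ring_Usl2)

text \<open>Elements of the enveloping algebra, of its quotient and of the module are all named by
  polynomials, through \<open>U_class\<close>, \<open>UI_class\<close> and \<open>M_class\<close>,
  so that calculations take place in the free algebra.\<close>

definition U_class :: "(complex^2^2) ncpoly \<Rightarrow> U_elt" where
  "U_class a = sl2_ideal +>\<^bsub>FA\<^esub> a"

lemma U_class_hom: "ring_hom_ring FA Usl2 U_class"
  unfolding Usl2_def U_class_def[abs_def] by (rule ideal.rcos_ring_hom_ring[OF ideal_sl2_ideal])

lemma carrier_Usl2: "carrier Usl2 = U_class ` carrier FA"
  by (auto simp: Usl2_def FactRing_def A_RCOSETS_def' U_class_def)

lemma U_class_eq_iff:
  assumes "a \<in> carrier FA" "b \<in> carrier FA"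
  shows "U_class a = U_class b \<longleftrightarrow> a - b \<in> sl2_ideal"
  using FA.quotient_eq_iff_same_a_r_cos[OF ideal_sl2_ideal assms] assms
  by (simp add: U_class_def)

lemma U_class_closed [simp]: "a \<in> carrier FA \<Longrightarrow> U_class a \<in> carrier Usl2"
  by (simp add: carrier_Usl2)

lemma U_class_simps:
  assumes "a \<in> carrier FA" "b \<in> carrier FA"
  shows "U_class (a + b) = U_class a \<oplus>\<^bsub>Usl2\<^esub> U_class b"
    and "U_class (a * b) = U_class a \<otimes>\<^bsub>Usl2\<^esub> U_class b"
    and "U_class (a - b) = U_class a \<ominus>\<^bsub>Usl2\<^esub> U_class b"
proof -
  interpret h: ring_hom_ring FA Usl2 U_class by (rule U_class_hom)
  show "U_class (a + b) = U_class a \<oplus>\<^bsub>Usl2\<^esub> U_class b" "U_class (a * b) = U_class a \<otimes>\<^bsub>Usl2\<^esub> U_class b"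
    using h.hom_add[OF assms] h.hom_mult[OF assms] unfolding FA_simps .
  show "U_class (a - b) = U_class a \<ominus>\<^bsub>Usl2\<^esub> U_class b"
    using h.hom_add[of a "- b"] h.hom_a_inv[OF assms(2)] assms by (simp add: a_minus_def)
qed

lemma U_class_one: "U_class 1 = \<one>\<^bsub>Usl2\<^esub>" and U_class_zero: "U_class 0 = \<zero>\<^bsub>Usl2\<^esub>"
proof -
  interpret h: ring_hom_ring FA Usl2 U_class by (rule U_class_hom)
  show "U_class 1 = \<one>\<^bsub>Usl2\<^esub>" "U_class 0 = \<zero>\<^bsub>Usl2\<^esub>"
    using h.hom_one h.hom_zero unfolding FA_simps .
qed

lemma U_const_eq: "U_const z = U_class (nc_const z)" and U_emb_eq: "U_emb A = U_class (nc_var A)"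
  by (simp_all add: U_const_def U_emb_def U_class_def)

lemma casimir_eq: "casimir = U_class casimir_lift"
proof -
  have h: "U_class (nc_var sl2_h) \<oplus>\<^bsub>Usl2\<^esub> \<one>\<^bsub>Usl2\<^esub> = U_class (nc_var sl2_h + 1)"
    by (simp add: U_class_simps U_class_one)
  have sq: "u [^]\<^bsub>Usl2\<^esub> (2::nat) = u \<otimes>\<^bsub>Usl2\<^esub> u" if "u \<in> carrier Usl2" for u
    using that by (simp add: numeral_2_eq_2)
  show ?thesis
    by (simp add: casimir_def casimir_lift_def U_const_eq U_emb_eq h sq)
      (simp add: U_class_simps)
qed

lemma casimir_lift_closed [simp]: "casimir_lift \<in> carrier FA"
  by (simp add: casimir_lift_def)

lemma I_ideal_eq: "I_ideal lam = genideal Usl2 {U_class (casimir_lift - nc_const ((lam + 1)\<^sup>2))}"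
  by (simp add: I_ideal_def casimir_eq U_const_eq U_class_simps)

lemma ideal_I_ideal: "ideal (I_ideal lam) Usl2"
  unfolding I_ideal_eq by (rule Usl2.genideal_ideal) simp

lemma ring_UI: "ring (UI lam)"
  unfolding UI_def by (rule ideal.quotient_is_ring[OF ideal_I_ideal])

definition UI_class :: "complex \<Rightarrow> (complex^2^2) ncpoly \<Rightarrow> U_elt set" where
  "UI_class lam a = UI_proj lam (U_class a)"

lemma carrier_UI: "carrier (UI lam) = UI_class lam ` carrier FA"
  unfolding UI_def UI_class_def UI_proj_def
  by (auto simp: FactRing_def A_RCOSETS_def' carrier_Usl2)

lemma UI_class_closed [simp]: "a \<in> carrier FA \<Longrightarrow> UI_class lam a \<in> carrier (UI lam)"
  by (simp add: carrier_UI)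

lemma UI_class_simps:
  assumes "a \<in> carrier FA" "b \<in> carrier FA"
  shows "UI_class lam (a + b) = UI_class lam a \<oplus>\<^bsub>UI lam\<^esub> UI_class lam b"
    and "UI_class lam (a * b) = UI_class lam a \<otimes>\<^bsub>UI lam\<^esub> UI_class lam b"
    and "UI_class lam 0 = \<zero>\<^bsub>UI lam\<^esub>"
    and "UI_class lam (a - b) = UI_class lam a \<ominus>\<^bsub>UI lam\<^esub> UI_class lam b"
proof -
  interpret h: ring_hom_ring Usl2 "UI lam" "UI_proj lam"
    unfolding UI_def UI_proj_def[abs_def] by (rule ideal.rcos_ring_hom_ring[OF ideal_I_ideal])
  show "UI_class lam (a + b) = UI_class lam a \<oplus>\<^bsub>UI lam\<^esub> UI_class lam b"
    "UI_class lam (a * b) = UI_class lam a \<otimes>\<^bsub>UI lam\<^esub> UI_class lam b"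
    "UI_class lam 0 = \<zero>\<^bsub>UI lam\<^esub>"
    "UI_class lam (a - b) = UI_class lam a \<ominus>\<^bsub>UI lam\<^esub> UI_class lam b"
    using assms by (simp_all add: UI_class_def U_class_simps U_class_zero h.hom_add h.hom_mult a_minus_def)
qed

lemma UI_class_eq_iff:
  assumes "a \<in> carrier FA" "b \<in> carrier FA"
  shows "UI_class lam a = UI_class lam b \<longleftrightarrow> U_class (a - b) \<in> I_ideal lam"
  using Usl2.quotient_eq_iff_same_a_r_cos[OF ideal_I_ideal[of lam], of "U_class a" "U_class b"] assms
  by (simp add: UI_class_def UI_proj_def U_class_simps)

lemma I_ideal_zero: "\<zero>\<^bsub>Usl2\<^esub> \<in> I_ideal lam"
  using additive_subgroup.zero_closed[OF ideal.axioms(1)[OF ideal_I_ideal]] .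

lemma UI_class_sl2_ideal:
  assumes "r \<in> sl2_ideal"
  shows "UI_class lam r = \<zero>\<^bsub>UI lam\<^esub>"
proof -
  have r: "r \<in> carrier FA" using ideal.Icarr[OF ideal_sl2_ideal assms] .
  have "U_class (r - 0) = U_class 0" using U_class_eq_iff[OF r, of 0] assms by simp
  then show ?thesis
    using UI_class_eq_iff[OF r, of 0 lam] I_ideal_zero UI_class_simps(3)[OF r r] U_class_zero by simp
qed

lemma UI_class_casimir: "UI_class lam casimir_lift = UI_class lam (nc_const ((lam + 1)\<^sup>2))"
  using Usl2.genideal_self'[of "U_class (casimir_lift - nc_const ((lam + 1)\<^sup>2))"]
  by (simp add: UI_class_eq_iff I_ideal_eq)

section \<open>The left ideal of polynomials whose class in the module is zero\<close>

definition left_kernel :: "complex \<Rightarrow> (complex^2^2) ncpoly set" where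
  "left_kernel lam = {a \<in> carrier FA. UI_class lam a \<in> C_left_ideal lam}"

lemma C_left_ideal_eq: "C_left_ideal lam = UI_class lam ` (\<lambda>b. b * nc_var sl2_C) ` carrier FA"
  unfolding C_left_ideal_def carrier_UI U_emb_eq UI_class_def[symmetric]
  by (auto simp: image_image UI_class_simps)

lemma left_kernel_iff:
  "a \<in> left_kernel lam \<longleftrightarrow> a \<in> carrier FA \<and> (\<exists>b\<in>carrier FA. UI_class lam a = UI_class lam (b * nc_var sl2_C))"
  by (auto simp: left_kernel_def C_left_ideal_eq)

lemma left_kernel_closed:
  "0 \<in> left_kernel lam"
  "a \<in> left_kernel lam \<Longrightarrow> b \<in> left_kernel lam \<Longrightarrow> a + b \<in> left_kernel lam"
  "a \<in> left_kernel lam \<Longrightarrow> b \<in> left_kernel lam \<Longrightarrow> a - b \<in> left_kernel lam"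
  "a \<in> carrier FA \<Longrightarrow> b \<in> left_kernel lam \<Longrightarrow> a * b \<in> left_kernel lam"
proof -
  show "0 \<in> left_kernel lam"
    unfolding left_kernel_iff by (auto intro!: bexI[of _ 0])
next
  assume "a \<in> left_kernel lam" "b \<in> left_kernel lam"
  then obtain a' b' where ab: "a \<in> carrier FA" "b \<in> carrier FA" "a' \<in> carrier FA" "b' \<in> carrier FA"
    "UI_class lam a = UI_class lam (a' * nc_var sl2_C)" "UI_class lam b = UI_class lam (b' * nc_var sl2_C)"
    by (auto simp: left_kernel_iff)
  have "UI_class lam (a + b) = UI_class lam ((a' + b') * nc_var sl2_C)"
    "UI_class lam (a - b) = UI_class lam ((a' - b') * nc_var sl2_C)"
    using ab by (simp_all add: UI_class_simps distrib_right left_diff_distrib)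
  then show "a + b \<in> left_kernel lam" "a - b \<in> left_kernel lam"
    using ab FA_closed(1,6) unfolding left_kernel_iff by blast+
next
  assume a: "a \<in> carrier FA" and "b \<in> left_kernel lam"
  then obtain b' where b: "b \<in> carrier FA" "b' \<in> carrier FA"
    "UI_class lam b = UI_class lam (b' * nc_var sl2_C)"
    by (auto simp: left_kernel_iff)
  have "UI_class lam (a * b) = UI_class lam (a * b' * nc_var sl2_C)"
    using a b by (simp add: UI_class_simps mult.assoc)
  then show "a * b \<in> left_kernel lam"
    using a b FA_closed(2) unfolding left_kernel_iff by blast
qed

lemma UI_class_zero_left_kernel:
  assumes "a \<in> carrier FA" "UI_class lam a = \<zero>\<^bsub>UI lam\<^esub>"
  shows "a \<in> left_kernel lam"
  using assms UI_class_simps(3)[OF assms(1) assms(1), of lam] unfolding left_kernel_iff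
  by (auto intro!: bexI[of _ 0])

text \<open>The Lie relations and the Casimir relation generate two-sided ideals and may be
  multiplied by \<open>b\<close> on the right; C generates only a left ideal and must itself stand
  on the right.\<close>

lemma left_kernel_relations:
  assumes "b \<in> carrier FA"
  shows "r \<in> sl2_relations \<Longrightarrow> r * b \<in> left_kernel lam"
    and "(casimir_lift - nc_const ((lam + 1)\<^sup>2)) * b \<in> left_kernel lam"
    and "b * nc_var sl2_C \<in> left_kernel lam"
proof -
  interpret UI: ring "UI lam" by (rule ring_UI)
  show "b * nc_var sl2_C \<in> left_kernel lam"
    using assms unfolding left_kernel_iff by auto
  show "(casimir_lift - nc_const ((lam + 1)\<^sup>2)) * b \<in> left_kernel lam"
    using assms
    by (intro UI_class_zero_left_kernel) (simp_all add: UI_class_simps UI_class_casimir a_minus_def UI.r_neg)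
  assume "r \<in> sl2_relations"
  then have "r \<in> sl2_ideal"
    unfolding sl2_ideal_def using FA.genideal_self[OF sl2_relations_subset] by blast
  then show "r * b \<in> left_kernel lam"
    using assms ideal.Icarr[OF ideal_sl2_ideal]
    by (intro UI_class_zero_left_kernel) (simp_all add: UI_class_simps UI_class_sl2_ideal)
qed

lemma left_kernel_subset: "left_kernel lam \<subseteq> carrier FA"
  by (auto simp: left_kernel_def)

definition M_class :: "complex \<Rightarrow> (complex^2^2) ncpoly \<Rightarrow> U_elt set set" where
  "M_class lam a = C_left_ideal lam +>\<^bsub>UI lam\<^esub> UI_class lam a"

lemma subgroup_C_left_ideal: "subgroup (C_left_ideal lam) (add_monoid (UI lam))"
proof -
  interpret UI: ring "UI lam" by (rule ring_UI)
  have C: "UI_class lam (nc_var sl2_C) \<in> carrier (UI lam)" by simp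
  have eq: "C_left_ideal lam = (\<lambda>b. b \<otimes>\<^bsub>UI lam\<^esub> UI_class lam (nc_var sl2_C)) ` carrier (UI lam)"
    unfolding C_left_ideal_def U_emb_eq UI_class_def[symmetric] by blast
  show ?thesis
    unfolding eq
  proof (rule UI.add.subgroupI)
    fix a b assume "a \<in> (\<lambda>b. b \<otimes>\<^bsub>UI lam\<^esub> UI_class lam (nc_var sl2_C)) ` carrier (UI lam)"
    then obtain a' where a: "a' \<in> carrier (UI lam)" "a = a' \<otimes>\<^bsub>UI lam\<^esub> UI_class lam (nc_var sl2_C)" by blast
    show "\<ominus>\<^bsub>UI lam\<^esub> a \<in> (\<lambda>b. b \<otimes>\<^bsub>UI lam\<^esub> UI_class lam (nc_var sl2_C)) ` carrier (UI lam)"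
      using a C by (intro image_eqI[of _ _ "\<ominus>\<^bsub>UI lam\<^esub> a'"]) (simp_all add: UI.l_minus)
    assume "b \<in> (\<lambda>b. b \<otimes>\<^bsub>UI lam\<^esub> UI_class lam (nc_var sl2_C)) ` carrier (UI lam)"
    then obtain b' where b: "b' \<in> carrier (UI lam)" "b = b' \<otimes>\<^bsub>UI lam\<^esub> UI_class lam (nc_var sl2_C)" by blast
    show "a \<oplus>\<^bsub>UI lam\<^esub> b \<in> (\<lambda>b. b \<otimes>\<^bsub>UI lam\<^esub> UI_class lam (nc_var sl2_C)) ` carrier (UI lam)"
      using a b C by (intro image_eqI[of _ _ "a' \<oplus>\<^bsub>UI lam\<^esub> b'"]) (simp_all add: UI.l_distr)
  qed (use C in auto)
qed

lemma M_class_eq_iff: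
  assumes "a \<in> carrier FA" "b \<in> carrier FA"
  shows "M_class lam a = M_class lam b \<longleftrightarrow> a - b \<in> left_kernel lam"
proof -
  interpret UI: ring "UI lam" by (rule ring_UI)
  show ?thesis
    unfolding M_class_def using assms
    by (subst UI.a_coset_eq_iff[OF subgroup_C_left_ideal])
      (simp_all add: left_kernel_def UI_class_simps)
qed

lemma M_C_simps:
  shows "carrier (M_C lam) = M_class lam ` carrier FA"
    and "\<zero>\<^bsub>M_C lam\<^esub> = M_class lam 0"
    and "a \<in> carrier FA \<Longrightarrow> b \<in> carrier FA \<Longrightarrow>
      M_class lam a \<oplus>\<^bsub>M_C lam\<^esub> M_class lam b = M_class lam (a + b)"
    and "a \<in> carrier FA \<Longrightarrow> b \<in> carrier FA \<Longrightarrow>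
      U_class a \<odot>\<^bsub>M_C lam\<^esub> M_class lam b = M_class lam (a * b)"
    and "M_C_component lam g = {M_class lam a | a. a \<in> carrier FA \<and> U_class a \<in> U_component g}"
proof -
  interpret UI: ring "UI lam" by (rule ring_UI)
  have CL: "C_left_ideal lam \<subseteq> carrier (UI lam)"
    using subgroup.subset[OF subgroup_C_left_ideal[of lam]] by simp
  have carr: "carrier (M_C lam) = a_rcosets\<^bsub>UI lam\<^esub> (C_left_ideal lam)"
    and zero: "\<zero>\<^bsub>M_C lam\<^esub> = C_left_ideal lam"
    and add: "add (M_C lam) = set_add (UI lam)"
    and smult: "u \<odot>\<^bsub>M_C lam\<^esub> x =
      (\<Union>b\<in>x. C_left_ideal lam +>\<^bsub>UI lam\<^esub> (UI_proj lam u \<otimes>\<^bsub>UI lam\<^esub> b))" for u x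
    by (simp_all add: M_C_def)
  show "carrier (M_C lam) = M_class lam ` carrier FA"
    unfolding carr A_RCOSETS_def' carrier_UI M_class_def[abs_def] by blast
  have zero_UI: "UI_class lam 0 = \<zero>\<^bsub>UI lam\<^esub>"
    by (rule UI_class_simps(3)[of 0 0]) simp_all
  show "\<zero>\<^bsub>M_C lam\<^esub> = M_class lam 0"
    unfolding zero M_class_def zero_UI using CL by simp
  show "M_class lam a \<oplus>\<^bsub>M_C lam\<^esub> M_class lam b = M_class lam (a + b)"
    if "a \<in> carrier FA" "b \<in> carrier FA" for a b
  proof -
    interpret S: abelian_subgroup "C_left_ideal lam" "UI lam"
      by (intro abelian_subgroupI3 additive_subgroupI subgroup_C_left_ideal UI.abelian_group_axioms)
    show ?thesis
      unfolding add M_class_def using that by (subst S.a_rcos_sum) (simp_all add: UI_class_simps)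
  qed
  show "U_class a \<odot>\<^bsub>M_C lam\<^esub> M_class lam b = M_class lam (a * b)"
    if ab: "a \<in> carrier FA" "b \<in> carrier FA" for a b
  proof -
    \<comment> \<open>Two representatives of a coset differ by an element of the left ideal, which
      multiplication by \<open>a\<close> on the left preserves. Thus all members of the union in the
      action coincide.\<close>
    have "C_left_ideal lam +>\<^bsub>UI lam\<^esub> (UI_class lam a \<otimes>\<^bsub>UI lam\<^esub> x) = M_class lam (a * b)"
      if x: "x \<in> M_class lam b" for x
    proof -
      obtain c where "c \<in> C_left_ideal lam" and x': "x = c \<oplus>\<^bsub>UI lam\<^esub> UI_class lam b"
        using x unfolding M_class_def a_r_coset_def' by blast
      then obtain c' where c: "c = UI_class lam c'" "c' \<in> left_kernel lam"
        unfolding left_kernel_def C_left_ideal_eq by auto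
      then have c': "c' \<in> carrier FA" using left_kernel_subset by blast
      have "UI_class lam a \<otimes>\<^bsub>UI lam\<^esub> x = UI_class lam (a * (c' + b))"
        using ab c c' x' by (simp add: UI_class_simps)
      then have "C_left_ideal lam +>\<^bsub>UI lam\<^esub> (UI_class lam a \<otimes>\<^bsub>UI lam\<^esub> x) = M_class lam (a * (c' + b))"
        by (simp add: M_class_def)
      also have "\<dots> = M_class lam (a * b)"
        using ab c c' left_kernel_closed(4)[OF ab(1) c(2)]
        by (subst M_class_eq_iff) (simp_all add: distrib_left)
      finally show ?thesis .
    qed
    \<comment> \<open>The union has to range over at least one representative, since an empty union
      would be the empty set instead of the coset.\<close>
    moreover have "UI_class lam b \<in> M_class lam b"
      unfolding M_class_def a_r_coset_def' using ab subgroup.one_closed[OF subgroup_C_left_ideal[of lam]]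
      by (auto intro!: bexI[of _ "\<zero>\<^bsub>UI lam\<^esub>"])
    ultimately show ?thesis
      unfolding smult UI_class_def[symmetric] by blast
  qed
  \<comment> \<open>Only elements of the carrier have a polynomial representative, and
    \<open>U_homogeneous\<close> does not mention the carrier.\<close>
  have "u \<in> carrier Usl2" if "U_homogeneous g u" for g u
    using that
  proof (induction rule: U_homogeneous.induct)
    case (gen A g)
    then have "A \<in> sl2"
      by (auto simp: pauli_component_def mat_scale_def sl2_iff sl2_B_def sl2_C_def split: if_splits)
    then show ?case by (simp add: U_emb_eq)
  qed (simp_all add: U_const_eq)
  then show "M_C_component lam g = {M_class lam a | a. a \<in> carrier FA \<and> U_class a \<in> U_component g}"
    unfolding M_C_component_def M_class_def UI_class_def U_component_def carrier_Usl2 by blast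
qed

section \<open>Identification of the module with the weight space\<close>

definition sl2_E :: "complex^2^2" where "sl2_E = mat_scale (1/2) sl2_h + mat_scale (\<i>/2) sl2_B"
definition sl2_F :: "complex^2^2" where "sl2_F = mat_scale (1/2) sl2_h + mat_scale (-\<i>/2) sl2_B"
definition sl2_H :: "complex^2^2" where "sl2_H = mat_scale (-\<i>) sl2_C"

lemma sl2_EFH_entries [simp]:
  "sl2_E$1$1 = 1/2" "sl2_E$1$2 = \<i>/2" "sl2_E$2$1 = \<i>/2" "sl2_E$2$2 = -1/2"
  "sl2_F$1$1 = 1/2" "sl2_F$1$2 = -\<i>/2" "sl2_F$2$1 = -\<i>/2" "sl2_F$2$2 = -1/2"
  "sl2_H$1$1 = 0" "sl2_H$1$2 = -\<i>" "sl2_H$2$1 = \<i>" "sl2_H$2$2 = 0"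
  by (simp_all add: sl2_E_def sl2_F_def sl2_H_def mat_scale_def sl2_B_def sl2_C_def)

lemma sl2_closed [simp]:
  "sl2_E \<in> sl2" "sl2_F \<in> sl2" "sl2_H \<in> sl2"
  "A \<in> sl2 \<Longrightarrow> mat_scale z A \<in> sl2" "A \<in> sl2 \<Longrightarrow> B \<in> sl2 \<Longrightarrow> A + B \<in> sl2"
  by (simp_all add: sl2_iff mat_scale_def)

lemma sl2_brackets:
  "lie_bracket sl2_E sl2_F = sl2_H"
  "lie_bracket sl2_H sl2_E = mat_scale 2 sl2_E"
  "lie_bracket sl2_H sl2_F = mat_scale (-2) sl2_F"
  by (simp_all add: vec_eq_iff forall_2 lie_bracket_def matrix_matrix_mult_def UNIV_2 mat_scale_def)

text \<open>The coefficients are those of \<open>mat_op\<close>, which is therefore the linear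
  extension of \<open>E_op\<close>, \<open>F_op\<close>, \<open>H_op\<close> from this
  basis.\<close>

lemma sl2_expansion:
  assumes "A \<in> sl2"
  shows "A = mat_scale (A$1$1 - \<i> * (A$1$2 + A$2$1) / 2) sl2_E +
    mat_scale (A$1$1 + \<i> * (A$1$2 + A$2$1) / 2) sl2_F +
    mat_scale (\<i> * (A$1$2 - A$2$1) / 2) sl2_H"
  using assms by (simp add: vec_eq_iff forall_2 mat_scale_def sl2_iff field_simps)

lemma mat_op_basis:
  "mat_op m sl2_E f = E_op m f" "mat_op m sl2_F f = F_op m f" "mat_op m sl2_H f = H_op f"
  by (simp_all add: mat_op_def)

text \<open>The monomial whose class in the module is the basis vector v_k.\<close>

definition ehat :: "int \<Rightarrow> (complex^2^2) ncpoly" where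
  "ehat k = (if k \<ge> 0 then nc_var sl2_E ^ nat k else nc_var sl2_F ^ nat (- k))"

text \<open>Steps away from weight 0 are equalities in the free algebra. Steps towards 0 hold only
  modulo the relations; see \<open>vE_ehat\<close> and \<open>vF_ehat\<close>.\<close>

lemma ehat_up: "k \<ge> 0 \<Longrightarrow> ehat (k + 1) = nc_var sl2_E * ehat k"
  and ehat_down: "k \<le> 0 \<Longrightarrow> ehat (k - 1) = nc_var sl2_F * ehat k"
  and ehat_0 [simp]: "ehat 0 = 1"
proof -
  show "ehat (k + 1) = nc_var sl2_E * ehat k" if "k \<ge> 0"
    using that by (simp add: ehat_def nat_add_distrib)
  show "ehat (k - 1) = nc_var sl2_F * ehat k" if "k \<le> 0"
  proof -
    have "nat (- (k - 1)) = Suc (nat (- k))" using that by simp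
    then show ?thesis using that by (cases "k = 0") (simp_all add: ehat_def)
  qed
qed (simp add: ehat_def)

lemma int_walk_induct [case_names zero up down]:
  fixes k :: int
  assumes "P 0" "\<And>k. k \<ge> 0 \<Longrightarrow> P k \<Longrightarrow> P (k + 1)" "\<And>k. k \<le> 0 \<Longrightarrow> P k \<Longrightarrow> P (k - 1)"
  shows "P k"
  using assms by (rule int_induct[of P 0])

lemma ehat_closed [simp]: "ehat k \<in> carrier FA"
  by (induction k rule: int_walk_induct) (simp_all add: ehat_up ehat_down)

lemma weight_space_induct [case_names delta add scale]:
  assumes "\<And>k. P (delta k)" "\<And>f g. P f \<Longrightarrow> P g \<Longrightarrow> P (f + g)" "\<And>z f. P f \<Longrightarrow> P (scale z f)"
  shows "P f"
proof -
  have "P (\<Sum>k\<in>S. scale (lookup f k) (delta k))" if "finite S" for S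
    using that
  proof (induction S rule: finite_induct)
    case empty
    then show ?case using assms(3)[OF assms(1), of 0] by simp
  qed (simp add: assms)
  from this[of "Poly_Mapping.keys f"] show ?thesis
    by (simp flip: weight_space_expansion[of f])
qed

text \<open>A linear section of the evaluation map \<open>a \<mapsto> rep m a (delta 0)\<close>, as
  \<open>rep_lift\<close> shows.\<close>

definition lift :: "weight_space \<Rightarrow> (complex^2^2) ncpoly" where
  "lift f = (\<Sum>k\<in>Poly_Mapping.keys f. nc_const (lookup f k) * ehat k)"

lemma lift_superset:
  assumes "finite S" "Poly_Mapping.keys f \<subseteq> S"
  shows "lift f = (\<Sum>k\<in>S. nc_const (lookup f k) * ehat k)"
  unfolding lift_def using assms by (intro sum.mono_neutral_left) (auto simp: in_keys_iff nc_const_simps)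

lemma lift_add: "lift (f + g) = lift f + lift g"
proof -
  let ?S = "Poly_Mapping.keys f \<union> Poly_Mapping.keys g"
  have "lift r = (\<Sum>k\<in>?S. nc_const (lookup r k) * ehat k)" if "r \<in> {f, g, f + g}" for r
    using that Poly_Mapping.keys_add[of f g] by (intro lift_superset) auto
  then show ?thesis by (simp add: nc_const_simps distrib_right sum.distrib)
qed

lemma lift_scale: "lift (scale z f) = nc_const z * lift f"
proof -
  have "lift (scale z f) = (\<Sum>k\<in>Poly_Mapping.keys f. nc_const (lookup (scale z f) k) * ehat k)"
    by (rule lift_superset) (auto simp: in_keys_iff)
  then show ?thesis by (simp add: lift_def nc_const_simps mult.assoc sum_distrib_left)
qed

lemma lift_delta: "lift (delta k) = ehat k"
  by (simp add: lift_def delta_def nc_const_simps)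

lemma lift_zero: "lift 0 = 0"
  by (simp add: lift_def)

lemma lift_closed [simp]: "lift f \<in> carrier FA"
  by (induction f rule: weight_space_induct) (simp_all add: lift_delta lift_add lift_scale)

lemma E_op_delta: "E_op m (delta k) = scale (up_coeff m k) (delta (k + 1))"
  and F_op_delta: "F_op m (delta k) = scale (up_coeff m (- k)) (delta (k - 1))"
  and H_op_delta: "H_op (delta k) = scale (2 * of_int k) (delta k)"
  by (rule poly_mapping_eqI, simp)+

text \<open>Away from weight 0 every transition coefficient is 1.\<close>

lemma rep_ehat: "rep m (ehat k) (delta 0) = delta k"
proof (induction k rule: int_walk_induct)
  case (up k)
  then show ?case by (simp add: ehat_up rep_mult mat_op_basis E_op_delta up_coeff_def)
next
  case (down k)
  then show ?case by (simp add: ehat_down rep_mult mat_op_basis F_op_delta up_coeff_def)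
qed simp

lemma rep_lift: "rep m (lift f) (delta 0) = f"
  by (induction f rule: weight_space_induct)
    (simp_all add: lift_delta rep_ehat lift_add rep_add lift_scale rep_mult)

text \<open>The ideal depends on \<open>lam\<close> only through the square of
  \<open>lam + 1\<close>, so a nonnegative \<open>m\<close> can serve negative \<open>lam\<close> as
  well.\<close>

locale weight_model =
  fixes lam :: complex and m :: int
  assumes m_nonneg: "0 \<le> m" and casimir_value: "(lam + 1)\<^sup>2 = (2 * of_int m + 1)\<^sup>2"
begin

text \<open>This congruence is compatible with multiplication on the left only. The defining
  relations are therefore stated below with an arbitrary right factor \<open>b\<close>.\<close>

definition left_cong (infix "\<asymp>" 50) where
  "a \<asymp> b \<longleftrightarrow> a - b \<in> left_kernel lam"

lemma cong_refl [simp]: "a \<asymp> a"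
  by (simp add: left_cong_def left_kernel_closed)

lemma cong_sym: "a \<asymp> b \<Longrightarrow> b \<asymp> a"
  unfolding left_cong_def using left_kernel_closed(3)[OF left_kernel_closed(1), of "a - b" lam] by simp

lemma cong_trans [trans]: "a \<asymp> b \<Longrightarrow> b \<asymp> c \<Longrightarrow> a \<asymp> c"
  unfolding left_cong_def using left_kernel_closed(2)[of "a - b" lam "b - c"] by simp

lemma cong_add: "a \<asymp> b \<Longrightarrow> c \<asymp> d \<Longrightarrow> a + c \<asymp> b + d"
  unfolding left_cong_def using left_kernel_closed(2)[of "a - b" lam "c - d"] by (simp add: algebra_simps)

lemma cong_diff: "a \<asymp> b \<Longrightarrow> c \<asymp> d \<Longrightarrow> a - c \<asymp> b - d"
  unfolding left_cong_def using left_kernel_closed(3)[of "a - b" lam "c - d"] by (simp add: algebra_simps)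

lemma cong_mult: "a \<asymp> b \<Longrightarrow> c \<in> carrier FA \<Longrightarrow> c * a \<asymp> c * b"
  unfolding left_cong_def using left_kernel_closed(4)[of c "a - b" lam] by (simp add: algebra_simps)

section \<open>The defining relations as congruences\<close>

lemma cong_var_add:
  assumes "A \<in> sl2" "B \<in> sl2" "b \<in> carrier FA"
  shows "nc_var (A + B) * b \<asymp> nc_var A * b + nc_var B * b"
proof -
  have "nc_var (A + B) - nc_var A - nc_var B \<in> sl2_relations"
    using assms unfolding sl2_relations_def by blast
  from left_kernel_relations(1)[OF assms(3) this] show ?thesis
    by (simp add: left_cong_def algebra_simps)
qed

lemma cong_var_scale:
  assumes "A \<in> sl2" "b \<in> carrier FA"
  shows "nc_var (mat_scale z A) * b \<asymp> nc_const z * (nc_var A * b)"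
proof -
  have "nc_var (mat_scale z A) - nc_const z * nc_var A \<in> sl2_relations"
    using assms unfolding sl2_relations_def by blast
  from left_kernel_relations(1)[OF assms(2) this] show ?thesis
    by (simp add: left_cong_def algebra_simps)
qed

lemma cong_bracket:
  assumes "A \<in> sl2" "B \<in> sl2" "b \<in> carrier FA"
  shows "nc_var A * (nc_var B * b) \<asymp> nc_var B * (nc_var A * b) + nc_var (lie_bracket A B) * b"
proof -
  have "nc_var A * nc_var B - nc_var B * nc_var A - nc_var (lie_bracket A B) \<in> sl2_relations"
    using assms unfolding sl2_relations_def by blast
  from left_kernel_relations(1)[OF assms(3) this] show ?thesis
    by (simp add: left_cong_def algebra_simps)
qed

abbreviation "vE \<equiv> nc_var sl2_E"
abbreviation "vF \<equiv> nc_var sl2_F"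
abbreviation "vH \<equiv> nc_var sl2_H"

lemma cong_expansion:
  assumes "A \<in> sl2" "b \<in> carrier FA"
  shows "nc_var A * b \<asymp> nc_const (A$1$1 - \<i> * (A$1$2 + A$2$1) / 2) * (vE * b) +
    nc_const (A$1$1 + \<i> * (A$1$2 + A$2$1) / 2) * (vF * b) +
    nc_const (\<i> * (A$1$2 - A$2$1) / 2) * (vH * b)"
proof -
  let ?u = "A$1$1 - \<i> * (A$1$2 + A$2$1) / 2" and ?v = "A$1$1 + \<i> * (A$1$2 + A$2$1) / 2"
    and ?w = "\<i> * (A$1$2 - A$2$1) / 2"
  have "nc_var A * b = nc_var (mat_scale ?u sl2_E + mat_scale ?v sl2_F + mat_scale ?w sl2_H) * b"
    using sl2_expansion[OF assms(1)] by (rule arg_cong)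
  also have "\<dots> \<asymp> nc_var (mat_scale ?u sl2_E + mat_scale ?v sl2_F) * b + nc_var (mat_scale ?w sl2_H) * b"
    using assms by (intro cong_var_add) simp_all
  also have "\<dots> \<asymp> nc_var (mat_scale ?u sl2_E) * b + nc_var (mat_scale ?v sl2_F) * b
    + nc_var (mat_scale ?w sl2_H) * b"
    using assms by (intro cong_var_add cong_add) simp_all
  also have "\<dots> \<asymp> nc_const ?u * (vE * b) + nc_const ?v * (vF * b) + nc_const ?w * (vH * b)"
    using assms by (intro cong_var_scale cong_add) simp_all
  finally show ?thesis .
qed

lemma cong_commutators:
  assumes "b \<in> carrier FA"
  shows "vE * (vF * b) \<asymp> vF * (vE * b) + vH * b"
    and "vH * (vE * b) \<asymp> vE * (vH * b) + nc_const 2 * (vE * b)"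
    and "vH * (vF * b) \<asymp> vF * (vH * b) + nc_const (- 2) * (vF * b)"
proof -
  show "vE * (vF * b) \<asymp> vF * (vE * b) + vH * b"
    using cong_bracket[of sl2_E sl2_F b] assms by (simp add: sl2_brackets)
  have "vH * (vE * b) \<asymp> vE * (vH * b) + nc_var (mat_scale 2 sl2_E) * b"
    using cong_bracket[of sl2_H sl2_E b] assms by (simp add: sl2_brackets)
  also have "\<dots> \<asymp> vE * (vH * b) + nc_const 2 * (vE * b)"
    using assms by (intro cong_add cong_var_scale) simp_all
  finally show "vH * (vE * b) \<asymp> vE * (vH * b) + nc_const 2 * (vE * b)" .
  have "vH * (vF * b) \<asymp> vF * (vH * b) + nc_var (mat_scale (-2) sl2_F) * b"
    using cong_bracket[of sl2_H sl2_F b] assms by (simp add: sl2_brackets)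
  also have "\<dots> \<asymp> vF * (vH * b) + nc_const (- 2) * (vF * b)"
    using assms by (intro cong_add cong_var_scale) simp_all
  finally show "vH * (vF * b) \<asymp> vF * (vH * b) + nc_const (- 2) * (vF * b)" .
qed

lemma nc_const_move:
  "nc_const z * (nc_const w * p) = nc_const (z * w) * p"
  "nc_var A * nc_const z = nc_const z * nc_var A"
  "nc_var A * (nc_const z * p) = nc_const z * (nc_var A * p)"
proof -
  show "nc_const z * (nc_const w * p) = nc_const (z * w) * p"
    by (simp add: nc_const_simps mult.assoc)
  show *: "nc_var A * nc_const z = nc_const z * nc_var A"
    by (rule nc_const_commute[symmetric])
  show "nc_var A * (nc_const z * p) = nc_const z * (nc_var A * p)"
    unfolding mult.assoc[symmetric] * ..
qed

text \<open>The counterpart of \<open>rep_casimir\<close> in the module itself: the Casimir element,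
  which acts by a scalar, is rewritten as 4FE + 2H + H^2 + 1 by means of the relations.\<close>

lemma cong_casimir:
  assumes "b \<in> carrier FA"
  shows "nc_const ((2 * of_int m + 1)\<^sup>2) * b \<asymp>
    nc_const 4 * (vF * (vE * b)) + nc_const 2 * (vH * b) + vH * (vH * b) + b"
proof -
  let ?r = "nc_const 4 * (vF * (vE * b)) + nc_const 2 * (vH * b) + vH * (vH * b) + b"
  let ?h = "nc_var sl2_h" and ?x = "nc_var sl2_x" and ?y = "nc_var sl2_y"
  define c1 :: "(complex^2^2) ncpoly" where "c1 = nc_const (- \<i> / 2)"
  define c2 :: "(complex^2^2) ncpoly" where "c2 = nc_const (\<i> / 2)"
  have h: "?h * c - (vE * c + vF * c) \<in> left_kernel lam" if "c \<in> carrier FA" for c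
    using cong_expansion[of sl2_h c] that by (simp add: left_cong_def nc_const_simps)
  have x: "?x * c - (c1 * (vE * c) + c2 * (vF * c) + c2 * (vH * c)) \<in> left_kernel lam"
    if "c \<in> carrier FA" for c
    using cong_expansion[of sl2_x c] that by (simp add: left_cong_def c1_def c2_def)
  have y: "?y * c - (c1 * (vE * c) + c2 * (vF * c) + c1 * (vH * c)) \<in> left_kernel lam"
    if "c \<in> carrier FA" for c
    using cong_expansion[of sl2_y c] that by (simp add: left_cong_def c1_def c2_def)
  \<comment> \<open>Turns the numeral 4 into a repeated sum, so that the terms cancel by additive
    normalisation.\<close>
  have four: "4 * p = p + (p + (p + p))" for p :: "(complex^2^2) ncpoly"
    by (simp only: numeral_Bit0 numeral_One distrib_right mult_1_left add.assoc)
  note comm = cong_commutators[OF assms, unfolded left_cong_def]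
  let ?dx = "?x * b - (c1 * (vE * b) + c2 * (vF * b) + c2 * (vH * b))"
  have c: "c1 \<in> carrier FA" "c2 \<in> carrier FA" by (simp_all add: c1_def c2_def)
  \<comment> \<open>The difference is written as a combination of known elements of the left kernel
    with factors on the left only: the expansions of h, x, y in terms of E, F, H, followed by the
    three commutators.\<close>
  have "casimir_lift * b - ?r =
    (?h * (?h * b) - (vE * (?h * b) + vF * (?h * b))) + (vE + vF + nc_const 2) * (?h * b - (vE * b + vF * b))
    + nc_const 4 * ((?y * (?x * b) - (c1 * (vE * (?x * b)) + c2 * (vF * (?x * b)) + c1 * (vH * (?x * b))))
      + (c1 * vE + c2 * vF + c1 * vH) * ?dx)
    + nc_const 2 * (vE * (vF * b) - (vF * (vE * b) + vH * b))
    - (vH * (vE * b) - (vE * (vH * b) + nc_const 2 * (vE * b)))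
    + (vH * (vF * b) - (vF * (vH * b) + nc_const (-2) * (vF * b)))"
    unfolding casimir_lift_def c1_def c2_def
    apply (simp add: distrib_left distrib_right right_diff_distrib left_diff_distrib mult.assoc nc_const_move)
    apply (simp add: nc_const_simps nc_const_numeral mult_2)
    apply (simp add: algebra_simps four)
    done
  also have "\<dots> \<in> left_kernel lam"
    using assms c by (intro left_kernel_closed h x y comm) simp_all
  finally have "casimir_lift * b \<asymp> ?r" by (simp add: left_cong_def)
  moreover have "casimir_lift * b \<asymp> nc_const ((2 * of_int m + 1)\<^sup>2) * b"
    using left_kernel_relations(2)[OF assms, of lam] by (simp add: left_cong_def casimir_value left_diff_distrib)
  ultimately show ?thesis using cong_sym cong_trans by blast
qed

section \<open>The action of E, F, H on the basis monomials\<close>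

lemma cong_const_mult: "a \<asymp> b \<Longrightarrow> nc_const z * a \<asymp> nc_const z * b"
  by (rule cong_mult) simp_all

text \<open>C annihilates the class of 1, so v_0 has weight 0; each factor E or F then changes the
  weight by 2 or -2.\<close>

lemma vH_ehat: "vH * ehat k \<asymp> nc_const (2 * of_int k) * ehat k"
proof (induction k rule: int_walk_induct)
  case zero
  have "vH * 1 \<asymp> nc_const (- \<i>) * (nc_var sl2_C * 1)"
    unfolding sl2_H_def by (rule cong_var_scale) simp_all
  also have "\<dots> \<asymp> nc_const (- \<i>) * 0"
    using left_kernel_relations(3)[of 1 lam] by (intro cong_const_mult) (simp add: left_cong_def)
  finally show ?case by (simp add: nc_const_simps)
next
  case (up k)
  have "vH * ehat (k + 1) \<asymp> vE * (vH * ehat k) + nc_const 2 * (vE * ehat k)"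
    using up by (simp add: ehat_up cong_commutators)
  also have "\<dots> \<asymp> vE * (nc_const (2 * of_int k) * ehat k) + nc_const 2 * (vE * ehat k)"
    using up by (intro cong_add cong_mult) simp_all
  also have "\<dots> = nc_const (2 * of_int k + 2) * (vE * ehat k)"
    by (simp only: nc_const_move nc_const_simps(3) distrib_right)
  also have "\<dots> = nc_const (2 * of_int (k + 1)) * ehat (k + 1)"
    using up by (simp add: ehat_up)
  finally show ?case .
next
  case (down k)
  have "vH * ehat (k - 1) \<asymp> vF * (vH * ehat k) + nc_const (- 2) * (vF * ehat k)"
    using down by (simp add: ehat_down cong_commutators)
  also have "\<dots> \<asymp> vF * (nc_const (2 * of_int k) * ehat k) + nc_const (- 2) * (vF * ehat k)"
    using down by (intro cong_add cong_mult) simp_all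
  also have "\<dots> = nc_const (2 * of_int k + - 2) * (vF * ehat k)"
    by (simp only: nc_const_move nc_const_simps(3) distrib_right)
  also have "\<dots> = nc_const (2 * of_int (k - 1)) * ehat (k - 1)"
    using down by (simp add: ehat_down)
  finally show ?case .
qed

text \<open>As the eigenvalue of H on v_k is known, the Casimir relation can be solved for FE: 4FE
  v_k = ((2m + 1)^2 - (2k + 1)^2) v_k.\<close>

lemma vF_vE_ehat: "vF * (vE * ehat k) \<asymp> nc_const (fe_scalar m k) * ehat k"
proof -
  let ?k = "of_int k :: complex"
  have HH: "vH * (vH * ehat k) \<asymp> nc_const (4 * ?k * ?k) * ehat k"
  proof -
    have "vH * (vH * ehat k) \<asymp> vH * (nc_const (2 * ?k) * ehat k)"
      by (intro cong_mult vH_ehat) simp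
    also have "\<dots> = nc_const (2 * ?k) * (vH * ehat k)"
      by (simp add: nc_const_move)
    also have "\<dots> \<asymp> nc_const (2 * ?k) * (nc_const (2 * ?k) * ehat k)"
      by (intro cong_const_mult vH_ehat)
    finally show ?thesis by (simp add: nc_const_move mult.assoc)
  qed
  let ?v = "nc_const 4 * (vF * (vE * ehat k))"
  have "?v + nc_const 2 * (vH * ehat k) + vH * (vH * ehat k) + ehat k
      - (nc_const 2 * (vH * ehat k) + vH * (vH * ehat k) + ehat k)
    \<asymp> nc_const ((2 * of_int m + 1)\<^sup>2) * ehat k
      - (nc_const 2 * (nc_const (2 * ?k) * ehat k) + nc_const (4 * ?k * ?k) * ehat k + ehat k)"
    by (intro cong_diff cong_add cong_const_mult vH_ehat HH cong_sym[OF cong_casimir] cong_refl) simp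
  also have "\<dots> = nc_const ((2 * of_int m + 1)\<^sup>2 - (2 * (2 * ?k) + 4 * ?k * ?k + 1)) * ehat k"
    by (simp only: nc_const_move nc_const_simps(2,3,4) distrib_right left_diff_distrib mult_1_left)
  also have "(2 * of_int m + 1)\<^sup>2 - (2 * (2 * ?k) + 4 * ?k * ?k + 1) = 4 * fe_scalar m k"
    by (simp add: fe_scalar_def power2_eq_square algebra_simps)
  finally have "?v \<asymp> nc_const (4 * fe_scalar m k) * ehat k" by simp
  then have "nc_const (1/4) * ?v \<asymp> nc_const (1/4) * (nc_const (4 * fe_scalar m k) * ehat k)"
    by (rule cong_const_mult)
  then show ?thesis by (simp add: nc_const_move nc_const_simps(2))
qed

text \<open>For k < 0 write v_k = F v_(k+1) and use EF = FE + H, with the known eigenvalues of FE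
  and H on v_(k+1).\<close>

lemma vE_ehat: "vE * ehat k \<asymp> nc_const (up_coeff m k) * ehat (k + 1)"
proof (cases "k \<ge> 0")
  case True
  then show ?thesis by (simp add: up_coeff_def ehat_up nc_const_simps(2))
next
  case False
  have "vE * ehat k = vE * (vF * ehat (k + 1))"
    using ehat_down[of "k + 1"] False by simp
  also have "\<dots> \<asymp> vF * (vE * ehat (k + 1)) + vH * ehat (k + 1)"
    by (rule cong_commutators) simp
  also have "\<dots> \<asymp> nc_const (fe_scalar m (k + 1)) * ehat (k + 1) + nc_const (2 * of_int (k + 1)) * ehat (k + 1)"
    by (intro cong_add vF_vE_ehat vH_ehat)
  also have "\<dots> = nc_const (fe_scalar m (k + 1) + 2 * of_int (k + 1)) * ehat (k + 1)"
    by (simp only: nc_const_simps(3) distrib_right)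
  also have "fe_scalar m (k + 1) + 2 * of_int (k + 1) = up_coeff m k"
    using False fe_scalar_diff[of m "k + 1"] by (simp add: up_coeff_def algebra_simps)
  finally show ?thesis .
qed

lemma vF_ehat: "vF * ehat k \<asymp> nc_const (up_coeff m (- k)) * ehat (k - 1)"
proof (cases "k \<le> 0")
  case True
  then show ?thesis by (simp add: up_coeff_def ehat_down nc_const_simps(2))
next
  case False
  then have "vF * ehat k = vF * (vE * ehat (k - 1))"
    using ehat_up[of "k - 1"] by simp
  also have "\<dots> \<asymp> nc_const (fe_scalar m (k - 1)) * ehat (k - 1)"
    by (rule vF_vE_ehat)
  also have "fe_scalar m (k - 1) = up_coeff m (- k)"
    using False fe_scalar_reflect[of m "k - 1"] by (simp add: up_coeff_def)
  finally show ?thesis .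
qed

lemma cong_lift_op:
  assumes "linear_op T" "A \<in> sl2" "\<And>k. nc_var A * ehat k \<asymp> lift (T (delta k))"
  shows "nc_var A * lift f \<asymp> lift (T f)"
proof (induction f rule: weight_space_induct)
  case (delta k)
  then show ?case using assms(3) by (simp add: lift_delta)
next
  case (add f g)
  then show ?case using assms(1) cong_add by (simp add: lift_add linear_op_def distrib_left)
next
  case (scale z f)
  then show ?case using assms(1) cong_const_mult by (simp add: lift_scale linear_op_def nc_const_move)
qed

text \<open>Modulo the left kernel \<open>lift\<close> is a homomorphism of modules. For
  \<open>f = delta 0\<close> it shows that every class in the module is a combination of the
  v_k.\<close>

lemma cong_lift:
  assumes "a \<in> carrier FA"
  shows "a * lift f \<asymp> lift (rep m a f)"
  using assms
proof (induction a arbitrary: f rule: FA_induct)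
  case (const z)
  then show ?case by (simp add: lift_scale)
next
  case (var A)
  have E: "vE * lift f \<asymp> lift (E_op m f)" and F: "vF * lift f \<asymp> lift (F_op m f)"
    and H: "vH * lift f \<asymp> lift (H_op f)"
    using vE_ehat vF_ehat vH_ehat
    by (auto intro!: cong_lift_op linear_ops simp: E_op_delta F_op_delta H_op_delta lift_scale lift_delta)
  let ?u = "A$1$1 - \<i> * (A$1$2 + A$2$1) / 2" and ?v = "A$1$1 + \<i> * (A$1$2 + A$2$1) / 2"
    and ?w = "\<i> * (A$1$2 - A$2$1) / 2"
  have "nc_var A * lift f \<asymp> nc_const ?u * (vE * lift f) + nc_const ?v * (vF * lift f) + nc_const ?w * (vH * lift f)"
    using var by (rule cong_expansion) simp
  also have "\<dots> \<asymp> nc_const ?u * lift (E_op m f) + nc_const ?v * lift (F_op m f) + nc_const ?w * lift (H_op f)"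
    by (intro cong_add cong_const_mult E F H)
  also have "\<dots> = lift (rep m (nc_var A) f)"
    by (simp only: lift_add lift_scale rep_var mat_op_def)
  finally show ?case .
next
  case (add a b)
  then show ?case using cong_add by (simp add: distrib_right rep_add lift_add)
next
  case (mult a b)
  have "a * (b * lift f) \<asymp> a * lift (rep m b f)"
    by (intro cong_mult mult)
  also have "\<dots> \<asymp> lift (rep m a (rep m b f))"
    by (rule mult)
  finally show ?case by (simp add: mult.assoc rep_mult)
qed

section \<open>Linear independence of the basis and the isomorphism with the weight space\<close>

lemma I_ideal_subset: "I_ideal lam \<subseteq> U_class ` rep_kernel m"
  unfolding I_ideal_eq
proof (rule Usl2.genideal_minimal)
  show "ideal (U_class ` rep_kernel m) Usl2"
    using FA.ring_ideal_imp_quot_ideal[OF ideal_sl2_ideal ideal_rep_kernel[of m]]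
    unfolding Usl2_def U_class_def[abs_def] .
  \<comment> \<open>The image of the kernel is an ideal, so it suffices that it contains the one
    generator, and the Casimir element acts by exactly this scalar.\<close>
  have "casimir_lift - nc_const ((lam + 1)\<^sup>2) \<in> rep_kernel m"
    by (simp add: rep_kernel_def rep_diff rep_casimir casimir_value)
  then show "{U_class (casimir_lift - nc_const ((lam + 1)\<^sup>2))} \<subseteq> U_class ` rep_kernel m" by blast
qed

text \<open>The action factors through the quotient by the Casimir relation, and C annihilates
  \<open>delta 0\<close>. Evaluation at \<open>delta 0\<close> is thus well defined on the module,
  which makes the v_k linearly independent.\<close>

lemma rep_left_kernel:
  assumes "a \<in> left_kernel lam"
  shows "rep m a (delta 0) = 0"
proof -
  obtain b where a: "a \<in> carrier FA" and b: "b \<in> carrier FA"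
    and "UI_class lam a = UI_class lam (b * nc_var sl2_C)"
    using assms by (auto simp: left_kernel_iff)
  then have "U_class (a - b * nc_var sl2_C) \<in> I_ideal lam"
    by (simp add: UI_class_eq_iff)
  then obtain c where c: "c \<in> rep_kernel m" "U_class (a - b * nc_var sl2_C) = U_class c"
    using I_ideal_subset by blast
  \<comment> \<open>Equality of the two classes places this difference in \<open>sl2_ideal\<close>,
    which acts by zero.\<close>
  then have "a - b * nc_var sl2_C - c \<in> rep_kernel m"
    using a b sl2_ideal_le_rep_kernel[of m] by (subst (asm) U_class_eq_iff) (auto simp: rep_kernel_def)
  then have "rep m a (delta 0) - rep m b (mat_op m sl2_C (delta 0)) - rep m c (delta 0) = 0"
    by (simp add: rep_kernel_def rep_diff rep_mult)
  then have "rep m a (delta 0) = rep m b (mat_op m sl2_C (delta 0)) + rep m c (delta 0)"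
    by (simp add: algebra_simps)
  moreover have "mat_op m sl2_C (delta 0) = 0"
    by (rule poly_mapping_eqI) (simp add: mat_op_def sl2_C_def)
  ultimately show ?thesis
    using c(1) by (simp add: rep_kernel_def linear_op_zero[OF linear_op_rep])
qed

text \<open>The isomorphism from the weight space onto the module; everything below is transported
  along it.\<close>

definition coset_of :: "weight_space \<Rightarrow> U_elt set set" where
  "coset_of f = M_class lam (lift f)"

lemma coset_of_eq_iff [simp]: "coset_of f = coset_of g \<longleftrightarrow> f = g"
proof
  assume "coset_of f = coset_of g"
  then have "lift f - lift g \<in> left_kernel lam"
    by (simp add: coset_of_def M_class_eq_iff)
  from rep_left_kernel[OF this] show "f = g" by (simp add: rep_diff rep_lift)
qed simp

lemma M_class_eq_coset_of:
  assumes "a \<in> carrier FA"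
  shows "M_class lam a = coset_of (rep m a (delta 0))"
  using cong_lift[OF assms, of "delta 0"] assms
  by (simp add: coset_of_def M_class_eq_iff left_cong_def lift_delta)

lemma M_C_coset_of:
  shows "carrier (M_C lam) = range coset_of"
    and "\<zero>\<^bsub>M_C lam\<^esub> = coset_of 0"
    and "coset_of f \<oplus>\<^bsub>M_C lam\<^esub> coset_of g = coset_of (f + g)"
    and "a \<in> carrier FA \<Longrightarrow> U_class a \<odot>\<^bsub>M_C lam\<^esub> coset_of f = coset_of (rep m a f)"
proof -
  have "M_class lam ` carrier FA = range coset_of"
  proof
    show "M_class lam ` carrier FA \<subseteq> range coset_of"
      by (auto simp: M_class_eq_coset_of)
    have "coset_of f \<in> M_class lam ` carrier FA" for f
      unfolding coset_of_def by (rule imageI) simp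
    then show "range coset_of \<subseteq> M_class lam ` carrier FA" by blast
  qed
  then show "carrier (M_C lam) = range coset_of"
    by (simp add: M_C_simps)
  show "\<zero>\<^bsub>M_C lam\<^esub> = coset_of 0"
    by (simp add: M_C_simps coset_of_def lift_zero)
  show "coset_of f \<oplus>\<^bsub>M_C lam\<^esub> coset_of g = coset_of (f + g)"
    by (simp add: M_C_simps coset_of_def lift_add)
  show "U_class a \<odot>\<^bsub>M_C lam\<^esub> coset_of f = coset_of (rep m a f)" if "a \<in> carrier FA"
    using that M_class_eq_coset_of[of "a * lift f"]
    by (simp add: M_C_simps coset_of_def rep_mult rep_lift)
qed

end

section \<open>Submodules\<close>

context weight_model
begin

text \<open>The counterpart of a submodule in the weight space; see
  \<open>submodule_M_on_iff\<close>.\<close>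

definition stable :: "weight_space set \<Rightarrow> bool" where
  "stable V \<longleftrightarrow> 0 \<in> V \<and> (\<forall>f\<in>V. \<forall>g\<in>V. f + g \<in> V) \<and> (\<forall>f\<in>V. \<forall>z. scale z f \<in> V) \<and>
    (\<forall>f\<in>V. E_op m f \<in> V \<and> F_op m f \<in> V \<and> H_op f \<in> V)"

lemma stableD:
  assumes "stable V"
  shows "0 \<in> V" "f \<in> V \<Longrightarrow> g \<in> V \<Longrightarrow> f + g \<in> V" "f \<in> V \<Longrightarrow> scale z f \<in> V"
    "f \<in> V \<Longrightarrow> E_op m f \<in> V" "f \<in> V \<Longrightarrow> F_op m f \<in> V" "f \<in> V \<Longrightarrow> H_op f \<in> V"
  using assms by (auto simp: stable_def)

lemma stable_uminus: "stable V \<Longrightarrow> f \<in> V \<Longrightarrow> - f \<in> V"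
proof -
  have "- f = scale (-1) f" by (rule poly_mapping_eqI) simp
  then show "stable V \<Longrightarrow> f \<in> V \<Longrightarrow> - f \<in> V" using stableD(3) by metis
qed

lemma stable_sum: "stable V \<Longrightarrow> (\<And>i. i \<in> I \<Longrightarrow> f i \<in> V) \<Longrightarrow> sum f I \<in> V"
  by (induction I rule: infinite_finite_induct) (auto intro: stableD)

lemma stable_UNIV [simp]: "stable UNIV"
  by (simp add: stable_def)

lemma stable_mat_op: "stable V \<Longrightarrow> f \<in> V \<Longrightarrow> mat_op m A f \<in> V"
  by (simp add: mat_op_def stableD)

lemma stable_rep:
  assumes "stable V" "a \<in> carrier FA" "f \<in> V"
  shows "rep m a f \<in> V"
  using assms(2,3)
  by (induction a arbitrary: f rule: FA_induct)
    (use assms(1) in \<open>simp_all add: rep_add rep_mult stableD stable_mat_op\<close>)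

lemma delta_mem:
  assumes "stable V" "f \<in> V" "lookup f k \<noteq> 0"
  shows "delta k \<in> V"
  using assms(2,3)
proof (induction "card (Poly_Mapping.keys f)" arbitrary: f rule: less_induct)
  case less
  show ?case
  proof (cases "Poly_Mapping.keys f \<subseteq> {k}")
    case True
    then have "scale (1 / lookup f k) f = delta k"
      using less.prems by (intro poly_mapping_eqI) (auto simp: in_keys_iff)
    then show ?thesis using stableD(3)[OF assms(1) less.prems(1)] by metis
  next
    case False
    then obtain j where j: "lookup f j \<noteq> 0" "j \<noteq> k" by (auto simp: in_keys_iff)
    \<comment> \<open>\<open>H - 2j\<close> removes the weight \<open>j\<close> and rescales the others by nonzero factors.\<close>
    define g where "g = H_op f + scale (- 2 * of_int j) f"
    have g: "lookup g i = 2 * of_int (i - j) * lookup f i" for i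
      by (simp add: g_def algebra_simps)
    have "Poly_Mapping.keys g \<subseteq> Poly_Mapping.keys f" by (auto simp: g in_keys_iff)
    moreover have "j \<in> Poly_Mapping.keys f" "j \<notin> Poly_Mapping.keys g"
      using j by (auto simp: g in_keys_iff)
    ultimately have "card (Poly_Mapping.keys g) < card (Poly_Mapping.keys f)"
      by (intro psubset_card_mono) auto
    moreover have "g \<in> V" using less.prems(1) assms(1) by (simp add: g_def stableD)
    moreover have "lookup g k \<noteq> 0" using j less.prems(2) by (simp add: g)
    ultimately show ?thesis by (rule less.hyps)
  qed
qed

text \<open>Together with \<open>delta_mem\<close>, this says that a stable subspace is determined
  by the basis vectors it contains, because the eigenvalues 2k of H are distinct.\<close>

lemma mem_if_deltas:
  assumes "stable V" "\<And>k. lookup f k \<noteq> 0 \<Longrightarrow> delta k \<in> V"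
  shows "f \<in> V"
  using weight_space_expansion[of f] stable_sum[OF assms(1), of "Poly_Mapping.keys f" "\<lambda>k. scale (lookup f k) (delta k)"]
    stableD(3)[OF assms(1) assms(2)] by (simp add: in_keys_iff)

text \<open>Of the two roots m and -m - 1 of \<open>fe_scalar\<close> only the negative one counts,
  as the coefficient is 1 for k \<ge> 0.\<close>

lemma up_coeff_eq_0_iff: "up_coeff m k = 0 \<longleftrightarrow> k = - m - 1"
proof -
  have "fe_scalar m k = 0 \<longleftrightarrow> k = m \<or> k = - m - 1"
    unfolding fe_scalar_def of_int_eq_0_iff by auto
  then show ?thesis using m_nonneg by (auto simp: up_coeff_def)
qed

text \<open>Raising can be undone up to scalars except at the step from -m - 1 to -m. The last
  hypothesis says that the walk from k to j does not cross this step.\<close>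

lemma delta_up:
  assumes "stable V" "delta k \<in> V" "k \<le> j" "- m \<le> k \<or> j < - m"
  shows "delta j \<in> V"
  using assms(3,4)
proof (induction j rule: int_ge_induct)
  case (step i)
  then have "delta i \<in> V" by auto
  then have "scale (1 / up_coeff m i) (E_op m (delta i)) \<in> V"
    by (intro stableD assms(1))
  moreover have "up_coeff m i \<noteq> 0" using step by (auto simp: up_coeff_eq_0_iff)
  ultimately show ?case by (simp add: E_op_delta)
qed (use assms in simp)

lemma delta_down:
  assumes "stable V" "delta k \<in> V" "j \<le> k" "k \<le> m \<or> m < j"
  shows "delta j \<in> V"
  using assms(3,4)
proof (induction j rule: int_le_induct)
  case (step i)
  then have "delta i \<in> V" by auto
  then have "scale (1 / up_coeff m (- i)) (F_op m (delta i)) \<in> V"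
    by (intro stableD assms(1))
  moreover have "up_coeff m (- i) \<noteq> 0" using step by (auto simp: up_coeff_eq_0_iff)
  ultimately show ?case by (simp add: F_op_delta)
qed (use assms in simp)

section \<open>The maximal stable subspace and its simplicity under reflection\<close>

definition outer_space :: "weight_space set" where
  "outer_space = {f. \<forall>k. \<bar>k\<bar> \<le> m \<longrightarrow> lookup f k = 0}"

lemma stable_outer_space: "stable outer_space"
  unfolding stable_def
proof (intro conjI ballI allI)
  fix f assume "f \<in> outer_space"
  then have f: "\<And>k. \<bar>k\<bar> \<le> m \<Longrightarrow> lookup f k = 0" by (simp add: outer_space_def)
  show "E_op m f \<in> outer_space"
    unfolding outer_space_def
  proof clarify
    fix k :: int assume "\<bar>k\<bar> \<le> m"
    \<comment> \<open>Raising can enter the inner weights from outside only at -m - 1, where the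
      coefficient vanishes.\<close>
    then have "k - 1 = - m - 1 \<or> \<bar>k - 1\<bar> \<le> m" by linarith
    then have "up_coeff m (k - 1) = 0 \<or> lookup f (k - 1) = 0"
      using f by (auto simp: up_coeff_eq_0_iff)
    then show "lookup (E_op m f) k = 0" by auto
  qed
  show "F_op m f \<in> outer_space"
    unfolding outer_space_def
  proof clarify
    fix k :: int assume "\<bar>k\<bar> \<le> m"
    then have "k = m \<or> \<bar>k + 1\<bar> \<le> m" by linarith
    then have "up_coeff m (- k - 1) = 0 \<or> lookup f (k + 1) = 0"
      using f by (auto simp: up_coeff_eq_0_iff)
    then show "lookup (F_op m f) k = 0" by auto
  qed
qed (auto simp: outer_space_def)

lemma delta_0_notin_outer_space: "delta 0 \<notin> outer_space"
  using m_nonneg by (auto simp: outer_space_def intro!: exI[of _ 0])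

lemma stable_cases:
  assumes "stable V" "\<not> V \<subseteq> outer_space"
  shows "V = UNIV"
proof -
  obtain f k where f: "f \<in> V" "\<bar>k\<bar> \<le> m" "lookup f k \<noteq> 0"
    using assms(2) by (auto simp: outer_space_def)
  then have k: "delta k \<in> V" using delta_mem assms(1) by blast
  have "delta j \<in> V" for j
    using delta_up[OF assms(1) k, of j] delta_down[OF assms(1) k, of j] f(2) by linarith
  then show ?thesis using mem_if_deltas[OF assms(1)] by blast
qed

lemma outer_space_reflect_simple:
  assumes "stable V" "V \<subseteq> outer_space" "V \<noteq> {0}" "\<And>f. f \<in> V \<Longrightarrow> reflect f \<in> V"
  shows "V = outer_space"
proof -
  obtain f where f: "f \<in> V" "f \<noteq> 0" using assms(3) stableD(1)[OF assms(1)] by blast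
  then obtain k where k: "lookup f k \<noteq> 0" using poly_mapping_eqI[of f 0] by auto
  have "reflect (delta k) = delta (- k)" by (rule poly_mapping_eqI) auto
  then have k': "delta k \<in> V" "delta (- k) \<in> V"
    using delta_mem[OF assms(1) f(1) k] assms(4)[of "delta k"] by simp_all
  have "f \<in> outer_space" using f(1) assms(2) by blast
  then have km: "\<bar>k\<bar> > m" using k by (auto simp: outer_space_def not_le[symmetric])
  \<comment> \<open>Reflection supplies one basis vector on each side, whatever the sign of
    k.\<close>
  obtain p where p: "p > m" "delta p \<in> V" "delta (- p) \<in> V"
  proof (cases "k > 0")
    case True
    then show ?thesis using that[of k] k' km by simp
  next
    case False
    then show ?thesis using that[of "- k"] k' km by simp
  qed
  \<comment> \<open>From p one reaches every index above m and from -p every index below -m, since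
    within each side neither vanishing step is crossed.\<close>
  have delta: "delta j \<in> V" if "\<bar>j\<bar> > m" for j
  proof (cases "j > 0")
    case True
    then show ?thesis
      using delta_up[OF assms(1) p(2), of j] delta_down[OF assms(1) p(2), of j] that p(1) m_nonneg
      by (cases "j \<ge> p") simp_all
  next
    case False
    then show ?thesis
      using delta_up[OF assms(1) p(3), of j] delta_down[OF assms(1) p(3), of j] that p(1) m_nonneg
      by (cases "j \<ge> - p") simp_all
  qed
  have "f \<in> V" if "f \<in> outer_space" for f
  proof (rule mem_if_deltas[OF assms(1)])
    fix k assume "lookup f k \<noteq> 0"
    with that have "\<bar>k\<bar> > m" by (auto simp: outer_space_def not_le[symmetric])
    then show "delta k \<in> V" by (rule delta)
  qed
  with assms(2) show ?thesis by blast
qed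

text \<open>One family for both modules: the whole space gives \<open>M_C lam\<close> and
  \<open>outer_space\<close> gives the maximal submodule, so that the module lemmas are proved
  once.\<close>

definition M_on :: "weight_space set \<Rightarrow> (U_elt, U_elt set set) module" where
  "M_on V = (M_C lam)\<lparr>carrier := coset_of ` V\<rparr>"

lemma M_on_UNIV: "M_on UNIV = M_C lam"
  by (simp add: M_on_def flip: M_C_coset_of(1))

lemma M_on_simps [simp]:
  "carrier (M_on V) = coset_of ` V"
  "\<zero>\<^bsub>M_on V\<^esub> = coset_of 0"
  "coset_of f \<oplus>\<^bsub>M_on V\<^esub> coset_of g = coset_of (f + g)"
  "a \<in> carrier FA \<Longrightarrow> U_class a \<odot>\<^bsub>M_on V\<^esub> coset_of f = coset_of (rep m a f)"
  using M_C_coset_of(2-4) by (simp_all add: M_on_def)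

lemma coset_of_mem_iff [simp]: "coset_of f \<in> coset_of ` V \<longleftrightarrow> f \<in> V"
  by auto

lemma abelian_group_M_on:
  assumes "stable V"
  shows "abelian_group (M_on V)"
proof (rule abelian_groupI)
  show "\<exists>y\<in>carrier (M_on V). y \<oplus>\<^bsub>M_on V\<^esub> x = \<zero>\<^bsub>M_on V\<^esub>" if "x \<in> carrier (M_on V)" for x
    using that stable_uminus[OF assms] by (auto intro!: bexI[of _ "- f" for f])
qed (use assms in \<open>auto simp: stableD add_ac\<close>)

lemma left_module_M_on:
  assumes "stable V"
  shows "left_module Usl2 (M_on V)"
proof (intro left_module.intro left_module_axioms.intro ring_Usl2 abelian_group_M_on assms)
  show "\<one>\<^bsub>Usl2\<^esub> \<odot>\<^bsub>M_on V\<^esub> x = x" if "x \<in> carrier (M_on V)" for x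
    using that by (auto simp flip: U_class_one)
qed (use linear_op_rep[of m] stable_rep[OF assms] in
    \<open>auto simp: carrier_Usl2 rep_add rep_mult linear_op_def simp flip: U_class_simps(1,2)\<close>)

text \<open>Scalars and traceless matrices generate the enveloping algebra, and E, F, H span these
  matrices. Invariance under E, F, H and scalars therefore gives invariance under the whole
  algebra.\<close>

lemma submodule_M_on_iff:
  assumes "stable V"
  shows "submodule W Usl2 (M_on V) \<longleftrightarrow> (\<exists>Y. stable Y \<and> Y \<subseteq> V \<and> W = coset_of ` Y)"
proof
  interpret abelian_group "M_on V" by (rule abelian_group_M_on[OF assms])
  assume "submodule W Usl2 (M_on V)"
  then interpret submodule W Usl2 "M_on V" .
  define Y where "Y = {f. coset_of f \<in> W}"
  have W: "W = coset_of ` Y" and sub: "Y \<subseteq> V"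
    using subset by (auto simp: Y_def)
  have act: "rep m a f \<in> Y" if "a \<in> carrier FA" "f \<in> Y" for a f
    using smult_closed[of "U_class a" "coset_of f"] that by (simp add: Y_def)
  have "0 \<in> Y" using one_closed by (simp add: Y_def)
  moreover have "f + g \<in> Y" if "f \<in> Y" "g \<in> Y" for f g
    using m_closed[of "coset_of f" "coset_of g"] that by (simp add: Y_def)
  ultimately have "stable Y"
    using act[OF nc_const_carrier] act[OF nc_var_carrier, of sl2_E] act[OF nc_var_carrier, of sl2_F]
      act[OF nc_var_carrier, of sl2_H]
    by (simp add: stable_def mat_op_basis)
  with W sub show "\<exists>Y. stable Y \<and> Y \<subseteq> V \<and> W = coset_of ` Y" by blast
next
  interpret abelian_group "M_on V" by (rule abelian_group_M_on[OF assms])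
  assume "\<exists>Y. stable Y \<and> Y \<subseteq> V \<and> W = coset_of ` Y"
  then obtain Y where Y: "stable Y" "Y \<subseteq> V" "W = coset_of ` Y" by blast
  have inv: "\<ominus>\<^bsub>M_on V\<^esub> (coset_of f) = coset_of (- f)" if "f \<in> Y" for f
    using that Y stable_uminus[OF assms] by (intro minus_equality) auto
  have "subgroup W (add_monoid (M_on V))"
    unfolding Y(3)
    using Y(1,2) stableD[OF Y(1)] by (intro add.subgroupI) (auto simp: inv stable_uminus)
  then show "submodule W Usl2 (M_on V)"
    by (intro submodule.intro submodule_axioms.intro)
      (auto simp: Y(3) carrier_Usl2 stable_rep[OF Y(1)])
qed

lemma submodule_M_C_iff: "submodule W Usl2 (M_C lam) \<longleftrightarrow> (\<exists>Y. stable Y \<and> W = coset_of ` Y)"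
  using submodule_M_on_iff[OF stable_UNIV] by (simp add: M_on_UNIV)

lemma coset_of_image_eq_iff: "coset_of ` V = coset_of ` Y \<longleftrightarrow> V = Y"
  by (intro inj_image_eq_iff injI) simp

text \<open>By \<open>stable_cases\<close> every proper submodule lies in this one. It is thus the
  greatest proper submodule, which yields both maximality and the uniqueness behind
  \<open>THE\<close>.\<close>

lemma N_C_eq: "N_C lam = coset_of ` outer_space"
  unfolding N_C_def
proof (rule the_equality)
  have ne: "coset_of ` outer_space \<noteq> range coset_of"
    using delta_0_notin_outer_space by (auto simp: coset_of_image_eq_iff)
  have sub: "submodule (coset_of ` outer_space) Usl2 (M_C lam)"
    unfolding submodule_M_C_iff using stable_outer_space by blast
  have max: "W \<subseteq> coset_of ` outer_space" if W: "submodule W Usl2 (M_C lam)" "W \<noteq> range coset_of" for W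
  proof -
    obtain Y where Y: "stable Y" "W = coset_of ` Y" using W(1) unfolding submodule_M_C_iff by blast
    then have "Y \<subseteq> outer_space" using W(2) stable_cases[OF Y(1)] by blast
    then show ?thesis unfolding Y(2) by (rule image_mono)
  qed
  show "maximal_submodule (coset_of ` outer_space) Usl2 (M_C lam)"
    unfolding maximal_submodule_def M_C_coset_of(1)
  proof (intro conjI allI impI sub ne)
    fix W assume "submodule W Usl2 (M_C lam) \<and> coset_of ` outer_space \<subseteq> W \<and> W \<noteq> range coset_of"
    then show "W = coset_of ` outer_space" using max by (intro equalityI) simp_all
  qed
  fix N assume "maximal_submodule N Usl2 (M_C lam)"
  then have "submodule N Usl2 (M_C lam)" "N \<noteq> range coset_of"
    and N: "\<And>W. submodule W Usl2 (M_C lam) \<Longrightarrow> N \<subseteq> W \<Longrightarrow> W \<noteq> range coset_of \<Longrightarrow> W = N"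
    unfolding maximal_submodule_def M_C_coset_of(1) by simp_all
  then have "N \<subseteq> coset_of ` outer_space" by (intro max)
  from N[OF sub this ne] show "N = coset_of ` outer_space" ..
qed

end

section \<open>The grading\<close>

declare split_paired_All [simp del]

definition bit_sign :: "bit \<Rightarrow> complex" where
  "bit_sign b = (if b = 0 then 1 else - 1)"

lemma bit_sign_simps [simp]: "bit_sign 0 = 1" "bit_sign 1 = -1"
  by (simp_all add: bit_sign_def)

definition parity_sign :: "int \<Rightarrow> complex" where
  "parity_sign k = (if even k then 1 else - 1)"

lemma parity_sign_simps [simp]:
  "parity_sign (k + 1) = - parity_sign k" "parity_sign (k - 1) = - parity_sign k"
  "parity_sign (- k) = parity_sign k" "parity_sign 0 = 1" "parity_sign (- 1 - k) = - parity_sign k"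
  by (simp_all add: parity_sign_def)

text \<open>The signs of both characters are dictated by the generators: h and B change the parity
  of k while C preserves it, and h commutes with the reflection while B and C anticommute with
  it.\<close>

definition parity_char :: "Z2sq \<Rightarrow> complex" where
  "parity_char g = bit_sign (fst g + snd g)"

definition reflect_char :: "Z2sq \<Rightarrow> complex" where
  "reflect_char g = bit_sign (snd g)"

lemma bit_sign_add: "bit_sign (a + b) = bit_sign a * bit_sign b"
  by (cases a; cases b; simp)

lemma char_simps [simp]:
  "parity_char 0 = 1" "parity_char (0, 0) = 1" "parity_char (0, 1) = -1"
  "parity_char (1, 0) = -1" "parity_char (1, 1) = 1"
  "reflect_char 0 = 1" "reflect_char (b, 0) = 1" "reflect_char (b, 1) = -1"
  "parity_char (g + h) = parity_char g * parity_char h"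
  "reflect_char (g + h) = reflect_char g * reflect_char h"
  by (simp_all only: parity_char_def reflect_char_def fst_add snd_add fst_zero snd_zero fst_conv
      snd_conv bit_sign_add bit_sign_simps mult_1_left mult_1_right mult_minus_left minus_minus
      mult.commute mult.left_commute)

definition degree_space :: "Z2sq \<Rightarrow> weight_space set" where
  "degree_space g = {f. \<forall>k. (lookup f k \<noteq> 0 \<longrightarrow> parity_sign k = parity_char g) \<and>
    lookup f (- k) = reflect_char g * lookup f k}"

lemma degree_spaceD:
  assumes "f \<in> degree_space g"
  shows "lookup f k \<noteq> 0 \<Longrightarrow> parity_sign k = parity_char g"
    and "lookup f (- k) = reflect_char g * lookup f k"
  using assms by (simp_all add: degree_space_def)

text \<open>The projector onto the joint eigenspace: signed averaging over the reflection, then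
  restriction to one parity.\<close>

definition degree_proj :: "Z2sq \<Rightarrow> weight_space \<Rightarrow> weight_space" where
  "degree_proj g f = scale (1/2) (restrict_weights {k. parity_sign k = parity_char g}
    (f + scale (reflect_char g) (reflect f)))"

lemma linear_op_degree_proj: "linear_op (degree_proj g)"
  by (auto simp: linear_op_def degree_proj_def algebra_simps intro!: poly_mapping_eqI)

lemma UNIV_Z2sq: "(UNIV :: Z2sq set) = {(0, 0), (0, 1), (1, 0), (1, 1)}"
  using bit_not_zero_iff by auto

lemma Z2sq_cases: "g = (0, 0) \<or> g = (0, 1) \<or> g = (1, 0) \<or> g = (1, 1)" for g :: Z2sq
  using UNIV_Z2sq by blast

lemma bit_add_self [simp]: "b + (b + c) = c" "c + b + b = c" "b + b = 0" for b c :: bit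
  by (cases b; cases c; simp)+

lemma Z2sq_add_self [simp]: "g + (g + h) = h" "h + g + g = h" "g + g = 0" for g h :: Z2sq
  by (simp_all only: prod_eq_iff fst_add snd_add fst_zero snd_zero bit_add_self)

lemma degree_proj_in: "degree_proj g f \<in> degree_space g"
  using Z2sq_cases[of g] by (auto simp: degree_space_def degree_proj_def parity_sign_def)

lemma sum_degree_proj: "(\<Sum>g\<in>UNIV. degree_proj g f) = f"
  by (rule poly_mapping_eqI) (simp add: UNIV_Z2sq lookup_sum degree_proj_def parity_sign_def add_divide_distrib diff_divide_distrib)

lemma degree_proj_degree_space:
  assumes "f \<in> degree_space h"
  shows "degree_proj g f = (if g = h then f else 0)"
proof (rule poly_mapping_eqI)
  fix k
  have "lookup f k = 0 \<or> parity_sign k = parity_char h" using degree_spaceD(1)[OF assms] by blast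
  then show "lookup (degree_proj g f) k = lookup (if g = h then f else 0) k"
    using degree_spaceD(2)[OF assms, of k] Z2sq_cases[of g] Z2sq_cases[of h]
    by (elim disjE) (auto simp: degree_proj_def parity_sign_def split: if_splits)
qed

text \<open>The projections recover the summands, so a homogeneous decomposition is unique.\<close>

lemma degree_proj_sum:
  assumes "\<And>g. F g \<in> degree_space g"
  shows "degree_proj g (\<Sum>h\<in>UNIV. F h) = F g"
proof -
  have "degree_proj g (sum F A) = (\<Sum>h\<in>A. degree_proj g (F h))" if "finite A" for A
    using that linear_op_degree_proj[of g] linear_op_zero[OF linear_op_degree_proj]
    by (induction A) (auto simp: linear_op_def)
  then have "degree_proj g (\<Sum>h\<in>UNIV. F h) = (\<Sum>h\<in>UNIV. if g = h then F h else 0)"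
    using degree_proj_degree_space[OF assms] by simp
  then show ?thesis by simp
qed

lemma zero_in_degree_space [simp]: "0 \<in> degree_space g"
  by (simp add: degree_space_def)

lemma degree_space_add: "f \<in> degree_space g \<Longrightarrow> f' \<in> degree_space g \<Longrightarrow> f + f' \<in> degree_space g"
  by (auto simp: degree_space_def distrib_left) (metis add_0)+

lemma degree_space_scale: "f \<in> degree_space g \<Longrightarrow> scale z f \<in> degree_space g"
  by (simp add: degree_space_def)

lemma degree_space_reflect: "f \<in> degree_space g \<Longrightarrow> reflect f = scale (reflect_char g) f"
  by (rule poly_mapping_eqI) (simp add: degree_space_def)

lemma delta_0_degree_space: "delta 0 \<in> degree_space 0"
  by (simp add: degree_space_def zero_prod_def)

section \<open>Homogeneity of the Pauli operators\<close>

lemma mat_op_pauli: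
  "mat_op m sl2_h f = E_op m f + F_op m f"
  "mat_op m sl2_B f = scale (- \<i>) (E_op m f - F_op m f)"
  "mat_op m sl2_C f = scale \<i> (H_op f)"
  by (rule poly_mapping_eqI, simp add: mat_op_def sl2_B_def sl2_C_def algebra_simps)+

lemma mat_op_degree_space:
  assumes A: "A \<in> pauli_component g" and f: "f \<in> degree_space g'"
  shows "mat_op m A f \<in> degree_space (g + g')"
proof -
  have par: "parity_sign k = - parity_char g'" if "lookup f (k + 1) \<noteq> 0 \<or> lookup f (k - 1) \<noteq> 0" for k
  proof -
    have "- parity_sign k = parity_char g'"
      using degree_spaceD(1)[OF f, of "k + 1"] degree_spaceD(1)[OF f, of "k - 1"] that by auto
    then show ?thesis by (metis minus_minus)
  qed
  have refl: "lookup f (- k - 1) = reflect_char g' * lookup f (k + 1)"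
    "lookup f (1 - k) = reflect_char g' * lookup f (k - 1)" for k
  proof -
    have "- k - 1 = - (k + 1)" "1 - k = - (k - 1)" by simp_all
    then show "lookup f (- k - 1) = reflect_char g' * lookup f (k + 1)"
      "lookup f (1 - k) = reflect_char g' * lookup f (k - 1)"
      by (simp_all only: degree_spaceD(2)[OF f])
  qed
  \<comment> \<open>Both operators change the parity, and the reflection exchanges them. Hence E + F
    commutes with the reflection and E - F anticommutes with it.\<close>
  have E: "lookup (E_op m f) k \<noteq> 0 \<Longrightarrow> parity_sign k = - parity_char g'"
    and F: "lookup (F_op m f) k \<noteq> 0 \<Longrightarrow> parity_sign k = - parity_char g'"
    and EF: "lookup (E_op m f) (- k) = reflect_char g' * lookup (F_op m f) k"
    and FE: "lookup (F_op m f) (- k) = reflect_char g' * lookup (E_op m f) k" for k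
    using par[of k] by (auto simp: refl)
  have sum: "parity_sign k = - parity_char g'"
    if "lookup (E_op m f + F_op m f) k \<noteq> 0 \<or> lookup (E_op m f - F_op m f) k \<noteq> 0" for k
  proof -
    have "lookup (E_op m f) k \<noteq> 0 \<or> lookup (F_op m f) k \<noteq> 0"
      using that by (auto simp del: lookup_ops)
    then show ?thesis using E F by blast
  qed
  have h: "mat_op m sl2_h f \<in> degree_space ((1, 0) + g')"
    unfolding degree_space_def mat_op_pauli
  proof (intro CollectI allI conjI impI)
    fix k
    show "lookup (E_op m f + F_op m f) (- k) = reflect_char ((1, 0) + g') * lookup (E_op m f + F_op m f) k"
      by (simp add: EF FE distrib_left del: lookup_ops)
  qed (use sum in simp)
  have B: "mat_op m sl2_B f \<in> degree_space ((0, 1) + g')"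
    unfolding mat_op_pauli
  proof (intro degree_space_scale, unfold degree_space_def, intro CollectI allI conjI impI)
    fix k
    show "lookup (E_op m f - F_op m f) (- k) = reflect_char ((0, 1) + g') * lookup (E_op m f - F_op m f) k"
      by (simp add: EF FE right_diff_distrib del: lookup_ops)
  qed (use sum in simp)
  have C: "mat_op m sl2_C f \<in> degree_space ((1, 1) + g')"
    unfolding mat_op_pauli
  proof (intro degree_space_scale, unfold degree_space_def, intro CollectI allI conjI impI)
    fix k
    show "parity_sign k = parity_char ((1, 1) + g')" if "lookup (H_op f) k \<noteq> 0"
      using that degree_spaceD(1)[OF f, of k] by simp
    show "lookup (H_op f) (- k) = reflect_char ((1, 1) + g') * lookup (H_op f) k"
      using degree_spaceD(2)[OF f, of k] by simp
  qed
  have zero: "mat_op m 0 f = 0" by (rule poly_mapping_eqI) (simp add: mat_op_def)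
  show ?thesis
    using A h B C by (auto simp: pauli_component_def mat_op_scale degree_space_scale zero split: if_splits)
qed

text \<open>A homogeneous operator permutes the degrees by g \<mapsto> h + g. This permutation is
  its own inverse, which is why \<open>h + g\<close> appears on the right.\<close>

lemma degree_proj_mat_op:
  assumes "A \<in> pauli_component h"
  shows "degree_proj g (mat_op m A f) = mat_op m A (degree_proj (h + g) f)"
proof -
  have sum: "mat_op m A (sum F S) = (\<Sum>g\<in>S. mat_op m A (F g))" for F :: "Z2sq \<Rightarrow> weight_space" and S
    using linear_op_mat_op[of m A] by (induction S rule: infinite_finite_induct) (auto simp: linear_op_def mat_op_zero)
  have "mat_op m A f = (\<Sum>g\<in>UNIV. mat_op m A (degree_proj g f))"
    by (simp add: sum_degree_proj flip: sum)
  also have "\<dots> = (\<Sum>g\<in>UNIV. mat_op m A (degree_proj (h + g) f))"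
    by (rule sum.reindex_bij_witness[of _ "\<lambda>g. h + g" "\<lambda>g. h + g"]) auto
  finally show ?thesis
    using degree_proj_sum[of "\<lambda>g. mat_op m A (degree_proj (h + g) f)" g]
      mat_op_degree_space[OF assms degree_proj_in, of m "h + _" f] by simp
qed

section \<open>Homogeneous elements of the enveloping algebra\<close>

lemma pauli_component_sl2: "A \<in> pauli_component g \<Longrightarrow> A \<in> sl2"
  by (auto simp: pauli_component_def mat_scale_def sl2_iff sl2_B_def sl2_C_def split: if_splits)

lemma zero_in_pauli_component: "0 \<in> pauli_component g"
proof -
  have "mat_scale 0 A = 0" for A by (simp add: mat_scale_def vec_eq_iff)
  then show ?thesis by (auto simp: pauli_component_def intro!: exI[of _ 0])
qed

lemma pauli_in_component:
  "sl2_h \<in> pauli_component (1, 0)" "sl2_B \<in> pauli_component (0, 1)"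
proof -
  have "mat_scale 1 A = A" for A by (simp add: mat_scale_def vec_eq_iff)
  then show "sl2_h \<in> pauli_component (1, 0)" "sl2_B \<in> pauli_component (0, 1)"
    by (auto simp: pauli_component_def intro!: exI[of _ 1])
qed

text \<open>A representative is assembled along the inductive generation of \<open>u\<close>.
  Applied to \<open>delta 0\<close>, which has degree 0, this bounds the components of the module
  from above.\<close>

lemma homogeneous_rep:
  assumes "U_homogeneous g u"
  shows "\<exists>a\<in>carrier FA. u = U_class a \<and> (\<forall>h. \<forall>f\<in>degree_space h. rep m a f \<in> degree_space (g + h))"
  using assms
proof (induction rule: U_homogeneous.induct)
  case (const z)
  show ?case
    by (intro bexI[of _ "nc_const z"]) (auto simp: U_const_eq degree_space_scale)
next
  case (gen A g)
  then show ?case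
    using pauli_component_sl2[OF gen] mat_op_degree_space[OF gen]
    by (intro bexI[of _ "nc_var A"]) (auto simp: U_emb_eq)
next
  case (add g u v)
  then obtain a b where "a \<in> carrier FA" "b \<in> carrier FA" "u = U_class a" "v = U_class b"
    "\<forall>h. \<forall>f\<in>degree_space h. rep m a f \<in> degree_space (g + h)"
    "\<forall>h. \<forall>f\<in>degree_space h. rep m b f \<in> degree_space (g + h)" by blast
  then show ?case
    by (intro bexI[of _ "a + b"]) (auto simp: U_class_simps rep_add degree_space_add)
next
  case (mult g u g' v)
  then obtain a b where "a \<in> carrier FA" "b \<in> carrier FA" "u = U_class a" "v = U_class b"
    "\<forall>h. \<forall>f\<in>degree_space h. rep m a f \<in> degree_space (g + h)"
    "\<forall>h. \<forall>f\<in>degree_space h. rep m b f \<in> degree_space (g' + h)" by blast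
  then show ?case
    by (intro bexI[of _ "a * b"]) (simp_all add: U_class_simps rep_mult add.assoc)
qed

text \<open>Serves the converse bound. All degrees are treated at once because E and F are not
  homogeneous: each mixes h and B, which have different degrees.\<close>

definition graded_reachable :: "int \<Rightarrow> weight_space \<Rightarrow> bool" where
  "graded_reachable m f \<longleftrightarrow>
    (\<forall>g. \<exists>a\<in>carrier FA. U_homogeneous g (U_class a) \<and> rep m a (delta 0) = degree_proj g f)"

lemma graded_reachable_add:
  assumes "graded_reachable m f" "graded_reachable m f'"
  shows "graded_reachable m (f + f')"
  unfolding graded_reachable_def
proof
  fix g
  obtain a b where "a \<in> carrier FA" "U_homogeneous g (U_class a)" "rep m a (delta 0) = degree_proj g f"
    "b \<in> carrier FA" "U_homogeneous g (U_class b)" "rep m b (delta 0) = degree_proj g f'"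
    using assms unfolding graded_reachable_def by blast
  then show "\<exists>a\<in>carrier FA. U_homogeneous g (U_class a) \<and> rep m a (delta 0) = degree_proj g (f + f')"
    using linear_op_degree_proj[of g]
    by (intro bexI[of _ "a + b"]) (auto simp: U_class_simps rep_add linear_op_def intro: U_homogeneous.add)
qed

lemma graded_reachable_scale:
  assumes "graded_reachable m f"
  shows "graded_reachable m (scale z f)"
  unfolding graded_reachable_def
proof
  fix g
  obtain a where a: "a \<in> carrier FA" "U_homogeneous g (U_class a)" "rep m a (delta 0) = degree_proj g f"
    using assms unfolding graded_reachable_def by blast
  have "U_homogeneous (0 + g) (U_const z \<otimes>\<^bsub>Usl2\<^esub> U_class a)"
    by (intro U_homogeneous.mult U_homogeneous.const a)
  with a show "\<exists>a\<in>carrier FA. U_homogeneous g (U_class a) \<and> rep m a (delta 0) = degree_proj g (scale z f)"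
    using linear_op_degree_proj[of g]
    by (intro bexI[of _ "nc_const z * a"]) (auto simp: U_class_simps U_const_eq rep_mult linear_op_def)
qed

lemma graded_reachable_mat_op:
  assumes "graded_reachable m f" "A \<in> pauli_component h"
  shows "graded_reachable m (mat_op m A f)"
  unfolding graded_reachable_def
proof
  fix g
  obtain a where a: "a \<in> carrier FA" "U_homogeneous (h + g) (U_class a)"
    "rep m a (delta 0) = degree_proj (h + g) f"
    using assms unfolding graded_reachable_def by blast
  have "U_homogeneous (h + (h + g)) (U_emb A \<otimes>\<^bsub>Usl2\<^esub> U_class a)"
    by (intro U_homogeneous.mult U_homogeneous.gen a assms)
  with a show "\<exists>a\<in>carrier FA. U_homogeneous g (U_class a) \<and> rep m a (delta 0) = degree_proj g (mat_op m A f)"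
    using pauli_component_sl2[OF assms(2)] degree_proj_mat_op[OF assms(2)]
    by (intro bexI[of _ "nc_var A * a"]) (auto simp: U_class_simps U_emb_eq rep_mult)
qed

lemma graded_reachable_E_F:
  assumes "graded_reachable m f"
  shows "graded_reachable m (E_op m f)" "graded_reachable m (F_op m f)"
proof -
  have "E_op m f = scale (1/2) (mat_op m sl2_h f) + scale (\<i>/2) (mat_op m sl2_B f)"
    "F_op m f = scale (1/2) (mat_op m sl2_h f) + scale (-\<i>/2) (mat_op m sl2_B f)"
    by (rule poly_mapping_eqI, simp add: mat_op_pauli algebra_simps)+
  then show "graded_reachable m (E_op m f)" "graded_reachable m (F_op m f)"
    using assms
    by (simp_all add: graded_reachable_add graded_reachable_scale graded_reachable_mat_op[OF _ pauli_in_component(1)]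
        graded_reachable_mat_op[OF _ pauli_in_component(2)])
qed

lemma graded_reachable_delta_0: "graded_reachable m (delta 0)"
  unfolding graded_reachable_def
proof
  fix g :: Z2sq
  show "\<exists>a\<in>carrier FA. U_homogeneous g (U_class a) \<and> rep m a (delta 0) = degree_proj g (delta 0)"
  proof (cases "g = 0")
    case True
    then show ?thesis
      using U_homogeneous.const[of 1] degree_proj_degree_space[OF delta_0_degree_space]
      by (intro bexI[of _ "nc_const 1"]) (auto simp: U_const_eq)
  next
    case False
    \<comment> \<open>As \<open>U_homogeneous.const\<close> only yields degree 0, the zero of degree \<open>g\<close> is taken to be a generator.\<close>
    have "mat_op m 0 (delta 0) = 0" by (rule poly_mapping_eqI) (simp add: mat_op_def)
    then show ?thesis
      using False U_homogeneous.gen[OF zero_in_pauli_component, of g]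
        degree_proj_degree_space[OF delta_0_degree_space] pauli_component_sl2[OF zero_in_pauli_component]
      by (intro bexI[of _ "nc_var 0"]) (auto simp: U_emb_eq)
  qed
qed

lemma graded_reachable: "graded_reachable m f"
proof (induction f rule: weight_space_induct)
  case (delta k)
  show ?case
  proof (induction k rule: int_walk_induct)
    case (up k)
    then show ?case using graded_reachable_E_F(1)[OF up(2)] by (simp add: E_op_delta up_coeff_def)
  next
    case (down k)
    then show ?case using graded_reachable_E_F(2)[OF down(2)] by (simp add: F_op_delta up_coeff_def)
  qed (rule graded_reachable_delta_0)
qed (auto intro: graded_reachable_add graded_reachable_scale)

section \<open>Transport of the grading to the module\<close>

context weight_model
begin

lemma M_C_component_eq: "M_C_component lam g = coset_of ` degree_space g"
proof
  show "M_C_component lam g \<subseteq> coset_of ` degree_space g"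
  proof
    fix x assume "x \<in> M_C_component lam g"
    then obtain a where "a \<in> carrier FA" "U_homogeneous g (U_class a)" and x: "x = M_class lam a"
      by (auto simp: M_C_simps(5) U_component_def)
    then obtain b where b: "b \<in> carrier FA" "U_class a = U_class b"
      and deg: "\<forall>h. \<forall>f\<in>degree_space h. rep m b f \<in> degree_space (g + h)"
      using homogeneous_rep[of g "U_class a" m] by blast
    \<comment> \<open>\<open>M_class\<close> depends on a polynomial only through its class in the
      enveloping algebra, so \<open>a\<close> may be replaced by \<open>b\<close>.\<close>
    have "x = coset_of (rep m b (delta 0))"
      using M_class_eq_coset_of[OF b(1)] b(2) x by (simp add: M_class_def UI_class_def)
    then show "x \<in> coset_of ` degree_space g"
      using deg delta_0_degree_space by fastforce
  qed
  show "coset_of ` degree_space g \<subseteq> M_C_component lam g"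
  proof clarify
    fix f assume "f \<in> degree_space g"
    then obtain a where "a \<in> carrier FA" "U_homogeneous g (U_class a)" "rep m a (delta 0) = f"
      using graded_reachable[of m f] degree_proj_degree_space[of f g g] unfolding graded_reachable_def by metis
    then show "coset_of f \<in> M_C_component lam g"
      using M_class_eq_coset_of[of a] by (auto simp: M_C_simps(5) U_component_def)
  qed
qed

lemma finsum_M_on:
  assumes "stable V" "finite S" "\<And>g. g \<in> S \<Longrightarrow> F g \<in> V"
  shows "finsum (M_on V) (\<lambda>g. coset_of (F g)) S = coset_of (sum F S)"
proof -
  interpret abelian_group "M_on V" by (rule abelian_group_M_on[OF assms(1)])
  show ?thesis
    using assms(2,3)
  proof (induction S)
    case (insert g S)
    then show ?case by (subst finsum_insert) auto
  qed simp
qed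

text \<open>Existence comes from the projections, which preserve \<open>Y\<close>, and uniqueness
  from \<open>degree_proj_sum\<close>. Separate \<open>V\<close> and \<open>Y\<close> allow one
  proof for the grading of the maximal submodule inside the whole module and on its own.\<close>

lemma internal_direct_sum_M_on:
  assumes V: "stable V" and Y: "stable Y" "Y \<subseteq> V" and proj: "\<And>g f. f \<in> Y \<Longrightarrow> degree_proj g f \<in> Y"
  shows "internal_direct_sum (M_on V) (\<lambda>g. coset_of ` (Y \<inter> degree_space g)) (coset_of ` Y)"
  unfolding internal_direct_sum_def
proof (intro conjI allI ballI)
  interpret abelian_group "M_on V" by (rule abelian_group_M_on[OF V])
  have inv: "\<ominus>\<^bsub>M_on V\<^esub> (coset_of f) = coset_of (- f)" if "f \<in> Y" for f
    using that Y stable_uminus[OF V] by (intro minus_equality) auto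
  have neg: "- f \<in> degree_space g" if "f \<in> degree_space g" for f g
    using that by (simp add: degree_space_def)
  show "subgroup (coset_of ` (Y \<inter> degree_space g)) (add_monoid (M_on V))" for g
    using Y stableD[OF Y(1)]
    by (intro add.subgroupI) (auto simp: inv neg stable_uminus degree_space_add intro: zero_in_degree_space)
  show "U_const z \<odot>\<^bsub>M_on V\<^esub> x \<in> coset_of ` (Y \<inter> degree_space g)"
    if "x \<in> coset_of ` (Y \<inter> degree_space g)" for g z x
    using that stableD[OF Y(1)] by (auto simp: U_const_eq degree_space_scale)
  have sum: "(\<Oplus>\<^bsub>M_on V\<^esub>g\<in>UNIV. coset_of (F g)) = coset_of (\<Sum>g\<in>UNIV. F g)"
    if "\<And>g. F g \<in> Y" for F :: "Z2sq \<Rightarrow> weight_space"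
    using that Y(2) by (intro finsum_M_on V) auto
  have rep: "\<exists>F. f = (\<lambda>g. coset_of (F g)) \<and> (\<forall>g. F g \<in> Y \<and> F g \<in> degree_space g)"
    if "f \<in> (\<Pi> g\<in>UNIV. coset_of ` (Y \<inter> degree_space g))" for f
  proof -
    have "\<forall>g. \<exists>y. f g = coset_of y \<and> y \<in> Y \<and> y \<in> degree_space g"
    proof
      fix g
      have "f g \<in> coset_of ` (Y \<inter> degree_space g)" using that by (rule PiE) simp_all
      then show "\<exists>y. f g = coset_of y \<and> y \<in> Y \<and> y \<in> degree_space g" by blast
    qed
    then have "\<exists>F. \<forall>g. f g = coset_of (F g) \<and> F g \<in> Y \<and> F g \<in> degree_space g" by (rule choice)
    then show ?thesis by (auto simp: fun_eq_iff)
  qed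
  show "(\<Oplus>\<^bsub>M_on V\<^esub>g\<in>UNIV. f g) \<in> coset_of ` Y"
    if "f \<in> (\<Pi> g\<in>UNIV. coset_of ` (Y \<inter> degree_space g))" for f
  proof -
    from rep[OF that] obtain F where F: "f = (\<lambda>g. coset_of (F g))" "\<forall>g. F g \<in> Y" by blast
    then show ?thesis using sum stable_sum[OF Y(1), of UNIV F] by simp
  qed
  show "\<exists>!f. f \<in> (\<Pi> g\<in>UNIV. coset_of ` (Y \<inter> degree_space g)) \<and> w = (\<Oplus>\<^bsub>M_on V\<^esub>g\<in>UNIV. f g)"
    if "w \<in> coset_of ` Y" for w
  proof -
    obtain y where y: "y \<in> Y" "w = coset_of y" using \<open>w \<in> coset_of ` Y\<close> by blast
    show ?thesis
    proof (rule ex1I[of _ "\<lambda>g. coset_of (degree_proj g y)"])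
      show "(\<lambda>g. coset_of (degree_proj g y)) \<in> (\<Pi> g\<in>UNIV. coset_of ` (Y \<inter> degree_space g)) \<and>
        w = (\<Oplus>\<^bsub>M_on V\<^esub>g\<in>UNIV. coset_of (degree_proj g y))"
        using y proj degree_proj_in sum[of "\<lambda>g. degree_proj g y"] by (auto simp: sum_degree_proj)
      fix f assume f: "f \<in> (\<Pi> g\<in>UNIV. coset_of ` (Y \<inter> degree_space g)) \<and> w = (\<Oplus>\<^bsub>M_on V\<^esub>g\<in>UNIV. f g)"
      then obtain F where F: "f = (\<lambda>g. coset_of (F g))" "\<forall>g. F g \<in> Y \<and> F g \<in> degree_space g"
        using rep by blast
      then have "y = (\<Sum>g\<in>UNIV. F g)" using f sum y by simp
      then show "f = (\<lambda>g. coset_of (degree_proj g y))"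
        using degree_proj_sum F by auto
    qed
  qed
qed

text \<open>The reflection acts on each homogeneous summand by a sign, so it preserves every
  subspace that contains the homogeneous components of its elements.\<close>

lemma reflect_internal_direct_sum:
  assumes V: "stable V" and Y: "stable Y" "Y \<subseteq> V"
    and sum: "internal_direct_sum (M_on V) (\<lambda>g. coset_of ` Y \<inter> coset_of ` (V \<inter> degree_space g)) (coset_of ` Y)"
    and f: "f \<in> Y"
  shows "reflect f \<in> Y"
proof -
  obtain c where c: "c \<in> (\<Pi> g\<in>UNIV. coset_of ` Y \<inter> coset_of ` (V \<inter> degree_space g))"
    and eq: "coset_of f = (\<Oplus>\<^bsub>M_on V\<^esub>g\<in>UNIV. c g)"
  proof -
    have "coset_of f \<in> coset_of ` Y" using f by simp
    with sum have "\<exists>!c. c \<in> (\<Pi> g\<in>UNIV. coset_of ` Y \<inter> coset_of ` (V \<inter> degree_space g)) \<and>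
      coset_of f = (\<Oplus>\<^bsub>M_on V\<^esub>g\<in>UNIV. c g)"
      unfolding internal_direct_sum_def by (elim conjE bspec)
    from ex1_implies_ex[OF this] show thesis using that by (elim exE conjE)
  qed
  have "\<forall>g. \<exists>y. c g = coset_of y \<and> y \<in> Y \<and> y \<in> degree_space g"
  proof
    fix g
    have "c g \<in> coset_of ` Y \<inter> coset_of ` (V \<inter> degree_space g)" using c by (rule PiE) simp_all
    then show "\<exists>y. c g = coset_of y \<and> y \<in> Y \<and> y \<in> degree_space g" by auto
  qed
  then have "\<exists>F. \<forall>g. c g = coset_of (F g) \<and> F g \<in> Y \<and> F g \<in> degree_space g" by (rule choice)
  then obtain F where "\<forall>g. c g = coset_of (F g) \<and> F g \<in> Y \<and> F g \<in> degree_space g" ..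
  then have F: "c g = coset_of (F g)" "F g \<in> Y" "F g \<in> degree_space g" for g
    by simp_all
  have "finsum (M_on V) (\<lambda>g. coset_of (F g)) UNIV = coset_of (\<Sum>g\<in>UNIV. F g)"
    using F(2) Y(2) by (intro finsum_M_on[OF V]) auto
  then have "f = (\<Sum>g\<in>UNIV. F g)" using eq F(1) by simp
  moreover have "reflect (sum F S) = (\<Sum>g\<in>S. reflect (F g))" for S
    by (rule poly_mapping_eqI) (simp add: lookup_sum)
  ultimately have "reflect f = (\<Sum>g\<in>UNIV. reflect (F g))" by simp
  also have "\<dots> = (\<Sum>g\<in>UNIV. scale (reflect_char g) (F g))"
    using degree_space_reflect[OF F(3)] by simp
  also have "\<dots> \<in> Y" by (intro stable_sum stableD(3) Y(1) F(2))
  finally show ?thesis .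
qed

section \<open>The graded structure of the maximal submodule\<close>

lemma degree_proj_outer_space: "f \<in> outer_space \<Longrightarrow> degree_proj g f \<in> outer_space"
  by (auto simp: outer_space_def degree_proj_def)

lemma N_C_module_eq: "N_C_module lam = M_on outer_space"
  by (simp add: N_C_module_def N_C_eq M_on_def)

lemma N_C_component_eq: "N_C_component lam g = coset_of ` (outer_space \<inter> degree_space g)"
  unfolding N_C_component_def N_C_eq M_C_component_eq by (intro image_Int[symmetric] injI) simp

lemma graded_submodule_N_C: "graded_submodule (N_C lam) (M_C lam) (M_C_component lam)"
proof -
  have "internal_direct_sum (M_on UNIV) (N_C_component lam) (N_C lam)"
    using internal_direct_sum_M_on[OF stable_UNIV stable_outer_space _ degree_proj_outer_space]
    by (simp add: N_C_component_eq[abs_def] N_C_eq)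
  then show ?thesis
    unfolding graded_submodule_def submodule_M_C_iff
    using stable_outer_space by (auto simp: M_on_UNIV N_C_component_def[abs_def] N_C_eq)
qed

lemma graded_module_N_C: "graded_module (N_C_module lam) (N_C_component lam)"
proof -
  have "internal_direct_sum (N_C_module lam) (N_C_component lam) (carrier (N_C_module lam))"
    using internal_direct_sum_M_on[OF stable_outer_space stable_outer_space order_refl degree_proj_outer_space]
    by (simp add: N_C_component_eq[abs_def] N_C_module_eq)
  moreover have "U_emb A \<odot>\<^bsub>N_C_module lam\<^esub> x \<in> N_C_component lam (g + g')"
    if "A \<in> pauli_component g" "x \<in> N_C_component lam g'" for g g' A x
    using that pauli_component_sl2[OF that(1)] mat_op_degree_space[OF that(1), of _ g']
      stable_mat_op[OF stable_outer_space]
    by (auto simp: N_C_component_eq N_C_module_eq U_emb_eq)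
  ultimately show ?thesis
    unfolding graded_module_def using left_module_M_on[OF stable_outer_space] by (simp add: N_C_module_eq)
qed

lemma graded_simple_N_C: "graded_simple (N_C_module lam) (N_C_component lam)"
  unfolding graded_simple_def
proof (intro conjI allI impI graded_module_N_C)
  fix W assume W: "graded_submodule W (N_C_module lam) (N_C_component lam)"
  then obtain Y where Y: "stable Y" "Y \<subseteq> outer_space" "W = coset_of ` Y"
    by (auto simp: graded_submodule_def N_C_module_eq submodule_M_on_iff[OF stable_outer_space])
  have "internal_direct_sum (M_on outer_space)
      (\<lambda>g. coset_of ` Y \<inter> coset_of ` (outer_space \<inter> degree_space g)) (coset_of ` Y)"
    using W by (simp add: graded_submodule_def N_C_module_eq N_C_component_eq Y(3))
  from reflect_internal_direct_sum[OF stable_outer_space Y(1,2) this]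
  have "Y = {0} \<or> Y = outer_space"
    using outer_space_reflect_simple[OF Y(1,2)] by blast
  then show "W = {\<zero>\<^bsub>N_C_module lam\<^esub>} \<or> W = carrier (N_C_module lam)"
    by (auto simp: Y(3) N_C_module_eq)
qed

end

theorem corollary3p14:
  fixes lam :: complex
  assumes "lam \<in> {2 * of_int k | k :: int. True}"
  shows "graded_submodule (N_C lam) (M_C lam) (M_C_component lam) \<and>
    graded_module (N_C_module lam) (N_C_component lam) \<and>
    graded_simple (N_C_module lam) (N_C_component lam)"
proof -
  obtain k :: int where k: "lam = 2 * of_int k" using assms by blast
  \<comment> \<open>For k < 0 the number 2k + 1 is the negative of 2m + 1 with m = -k - 1, so the
    squares agree and m is nonnegative.\<close>
  have "weight_model lam (if k \<ge> 0 then k else - k - 1)"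
    by unfold_locales (auto simp: k power2_eq_square algebra_simps)
  then show ?thesis
    using weight_model.graded_submodule_N_C weight_model.graded_module_N_C weight_model.graded_simple_N_C
    by blast
qed

end
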